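(* Let $P$ be an $n$-dimensional Gorenstein lattice polytope in $\mathbb{R}^n$ of degree $d$. Then $P$ decomposes as a Cayley sum of lattice polytopes in $\mathbb{R}^q$ for some $q\le 2d-1$.
   Context: For an $n$-dimensional lattice polytope $P\subset\mathbb{R}^n$, write $\sum_{m\ge0}|mP\cap\mathbb{Z}^n|t^m = h^*_P(t)/(1-t)^{n+1}$ with $h^*_P(t)=h^*_0+\dots+h^*_dt^d$ a polynomial of degree $d$, the degree of $P$. $P$ is Gorenstein if $h^*_i=h^*_{d-i}$ for $0\le i\le d$. If $P_0,\dots,P_s$ are lattice polytopes in $\mathbb{R}^q$, their Cayley sum $P_0*\cdots*P_s$ is the convex hull of $(P_0\times 0)\cup(P_1\times e_1)\cup\cdots\cup(P_s\times e_s)$ in $\mathbb{R}^q\times\mathbb{R}^s$ ($e_i$ the standard basis). $P$ decomposes as a Cayley sum of lattice polytopes in $\mathbb{R}^q$ if some affine isomorphism $\mathbb{R}^n\cong\mathbb{R}^q\times\mathbb{R}^s$ mapping $\mathbb{Z}^n$ onto $\mathbb{Z}^{q}\times\mathbb{Z}^s$ identifies $P$ with $P_0*\cdots*P_s$ for some lattice polytopes $P_0,\dots,P_s\subset\mathbb{R}^q$.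
   Formalization: For degree d = 0 the bound q ≤ 2d−1 = −1 cannot hold (e.g. the unit segment [0,1]); the formal statement instead gives q ≤ 0 in that case, and it takes n ≥ 1; for d ≥ 1 the bound is as stated. *)

theory Defs
  imports "HOL-Analysis.Analysis" "HOL-Computational_Algebra.Formal_Power_Series"
begin

definition integral_vec :: "real^'n \<Rightarrow> bool" where
  "integral_vec x \<longleftrightarrow> (\<forall>i. x $ i \<in> \<int>)"

definition lattice_polytope :: "(real^'n) set \<Rightarrow> bool" where
  "lattice_polytope P \<longleftrightarrow>
     (\<exists>V. finite V \<and> V \<noteq> {} \<and> (\<forall>v\<in>V. integral_vec v) \<and> P = convex hull V)"

definition ehrhart :: "(real^'n) set \<Rightarrow> nat \<Rightarrow> nat" where
  "ehrhart P m = card {x. x \<in> (\<lambda>y. real m *\<^sub>R y) ` P \<and> integral_vec x}"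

definition hstar :: "(real^'n) set \<Rightarrow> int fps" where
  "hstar P = Abs_fps (\<lambda>m. int (ehrhart P m)) * (1 - fps_X) ^ (CARD('n) + 1)"

definition has_degree :: "(real^'n) set \<Rightarrow> nat \<Rightarrow> bool" where
  "has_degree P d \<longleftrightarrow> fps_nth (hstar P) d \<noteq> 0 \<and> (\<forall>i>d. fps_nth (hstar P) i = 0)"

definition gorenstein :: "(real^'n) set \<Rightarrow> bool" where
  "gorenstein P \<longleftrightarrow> (\<exists>d. has_degree P d \<and>
      (\<forall>i\<le>d. fps_nth (hstar P) i = fps_nth (hstar P) (d - i)))"

definition lattice_affine_iso :: "(real^'n \<Rightarrow> real^'n) \<Rightarrow> bool" where
  "lattice_affine_iso T \<longleftrightarrow> (\<exists>(M::real^'n^'n) b.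
      (\<forall>i j. M $ i $ j \<in> \<int>) \<and> (det M = 1 \<or> det M = -1) \<and> integral_vec b \<and>
      (\<forall>x. T x = M *v x + b))"

text \<open>Cayley decomposition with respect to a set S of s coordinates (R^n = R^q x R^s,
  q = n - card S): P is the convex hull of (P_0 x 0) and (P_k x e_k), k \<in> S, where the
  P_j are lattice polytopes in the coordinate subspace R^q = {x. x$k = 0 for k \<in> S}.\<close>
definition cayley_decomp_coords :: "(real^'n) set \<Rightarrow> 'n set \<Rightarrow> bool" where
  "cayley_decomp_coords P S \<longleftrightarrow> (\<exists>Q :: 'n option \<Rightarrow> (real^'n) set.
      (\<forall>j \<in> insert None (Some ` S). lattice_polytope (Q j) \<and>
           (\<forall>x\<in>Q j. \<forall>k\<in>S. x $ k = 0)) \<and>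
      P = convex hull (Q None \<union> (\<Union>k\<in>S. (\<lambda>x. x + axis k 1) ` Q (Some k))))"

definition cayley_decomposes_in_dim :: "(real^'n) set \<Rightarrow> nat \<Rightarrow> bool" where
  "cayley_decomposes_in_dim P q \<longleftrightarrow> (\<exists>T S. lattice_affine_iso T \<and>
      card S + q = CARD('n) \<and> cayley_decomp_coords (T ` P) S)"

end

theory Submission
  imports Defs "HOL-Computational_Algebra.Polynomial"
begin

text \<open>
  Let \<open>C\<close> be the cone over \<open>P \<times> {1}\<close> and \<open>u\<close> the height functional. For a generic cost vector, the bases
  that are optimal for the linear programs \<open>min \<Sum> \<omega> c, \<Sum> c v = x\<close> triangulate \<open>C\<close>. Perturbing points in a
  generic interior direction \<open>g\<close>, respectively \<open>- g\<close>, cuts \<open>C\<close>, respectively its interior, into disjoint half-open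
  simplicial cones, and reflecting the half-open boxes gives Ehrhart reciprocity. A palindromic \<open>h\<^sup>*\<close> of
  degree \<open>d\<close> then forces the interior lattice points of \<open>C\<close> to be \<open>m + C\<close> for a lattice point \<open>m\<close> of height
  \<open>n + 1 - d\<close>. Hence the vertices of the slice \<open>y \<bullet> m = 1\<close> of the dual cone are lattice points. Writing \<open>u\<close> in
  linearly independent vertices and rounding the coefficients down shows that \<open>u\<close> is a sum of at
  least \<open>n + 2 - 2 d\<close> nonzero lattice points of the dual cone (\<open>n + 1\<close> if \<open>d = 0\<close>). On vertices of \<open>P\<close> these summands take the
  values 0 and 1, exactly one of them being 1; they extend to a lattice basis, which exhibits \<open>P\<close> as a Cayley sum.
\<close>

section \<open>Generic weights and nonnegative combinations\<close>

text \<open>The constants come from evaluation at \<open>m\<close>. The chosen vertices of the slice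
  have value 1 at \<open>m\<close>, so the coefficients of \<open>u\<close> sum to its height
  \<open>n + 1 - d\<close>. Their fractional parts sum to at most \<open>d\<close>; hence at least
  \<open>n + 1 - 2 d\<close> summands survive rounding, and a nonzero remainder is itself one more
  summand. With \<open>s + 1\<close> summands only \<open>s\<close> coordinates are used up, whence
  \<open>q = n - s \<le> 2 d - 1\<close>. If there is no remainder, \<open>n + 1 - d\<close>
  summands are present, which is enough for \<open>d > 0\<close>; for \<open>d = 0\<close> it gives
  \<open>q = 0\<close>, in accordance with truncated subtraction. The obstacle is integrality of the
  vertices of the slice, which are only rational a priori. Because interior lattice points lie in
  \<open>m + C\<close>, a vertex takes no value strictly between 0 and 1 on lattice points;
  subtracting multiples of \<open>m\<close> then makes all its values on the lattice integers.
  Half-open pieces are used because closed simplicial cones share boundary points: disjointness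
  makes lattice point counts additive without inclusion-exclusion.\<close>

lemma exists_generic_weights:
  fixes F :: "('a \<Rightarrow> real) set"
  assumes "finite F" "finite V" and nz: "\<And>a. a \<in> F \<Longrightarrow> \<exists>v\<in>V. a v \<noteq> 0"
  shows "\<exists>c. (\<forall>v. c v > 0) \<and> (\<forall>a\<in>F. (\<Sum>v\<in>V. a v * c v) \<noteq> 0)"
proof -
  obtain e :: "'a \<Rightarrow> nat" where e: "inj_on e V"
    using finite_imp_inj_to_nat_seg[OF \<open>finite V\<close>] by blast
  \<comment> \<open>At the weights \<open>t ^ e v\<close> with distinct exponents, each linear form
    becomes a nonzero polynomial in \<open>t\<close>. All but finitely many positive
    \<open>t\<close> avoid the roots of all of them.\<close>
  define p where "p a = (\<Sum>v\<in>V. monom (a v) (e v))" for a :: "'a \<Rightarrow> real"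
  have pnz: "p a \<noteq> 0" if aF: "a \<in> F" for a
  proof -
    obtain w where w: "w \<in> V" "a w \<noteq> 0" using nz[OF aF] by blast
    have "coeff (p a) (e w) = (\<Sum>v\<in>V. if v = w then a v else 0)"
      unfolding p_def coeff_sum coeff_monom
      by (intro sum.cong) (use e w in \<open>auto dest: inj_onD\<close>)
    also have "\<dots> = a w" using w \<open>finite V\<close> by simp
    finally show ?thesis using w by auto
  qed
  have "finite (\<Union>a\<in>F. {x. poly (p a) x = 0})"
    using \<open>finite F\<close> pnz poly_roots_finite by blast
  moreover have "infinite {0::real<..}" by (rule infinite_Ioi)
  ultimately have "\<not> {0<..} \<subseteq> (\<Union>a\<in>F. {x. poly (p a) x = 0})"
    using finite_subset by blast
  then obtain t where t: "t > 0" "\<forall>a\<in>F. poly (p a) t \<noteq> 0"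
    by auto
  have "poly (p a) t = (\<Sum>v\<in>V. a v * t ^ e v)" for a
    by (simp add: p_def poly_sum poly_monom)
  with t show ?thesis by (intro exI[of _ "\<lambda>v. t ^ e v"]) auto
qed

text \<open>The ratio test: the least quotient \<open>c v / a v\<close> over the positive entries of
  \<open>a\<close> is the largest step that keeps \<open>c - t a\<close> nonnegative, and it
  annihilates an entry. It serves both the removal of dependent generators and the simplex
  pivot.\<close>

lemma min_ratio:
  fixes a c :: "'a \<Rightarrow> real"
  assumes "finite V" "w \<in> V" "a w > 0" and c: "\<And>v. v \<in> V \<Longrightarrow> c v \<ge> 0"
  shows "\<exists>t\<ge>0. \<exists>v0\<in>V. a v0 > 0 \<and> c v0 = t * a v0 \<and> (\<forall>v\<in>V. c v - t * a v \<ge> 0)"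
proof -
  let ?W = "{v\<in>V. a v > 0}"
  have "finite ?W" "?W \<noteq> {}" using assms by auto
  then obtain v0 where v0: "v0 \<in> ?W" "\<And>v. v \<in> ?W \<Longrightarrow> c v0 / a v0 \<le> c v / a v"
    using ex_is_arg_min_if_finite[of ?W "\<lambda>v. c v / a v"]
    by (auto simp: is_arg_min_linorder)
  show ?thesis
  proof (rule exI[of _ "c v0 / a v0"], intro conjI bexI[of _ v0] ballI)
    show "c v0 / a v0 \<ge> 0" "v0 \<in> V" "a v0 > 0" "c v0 = c v0 / a v0 * a v0"
      using v0(1) c by auto
    show "c v - c v0 / a v0 * a v \<ge> 0" if "v \<in> V" for v
    proof (cases "a v > 0")
      case True
      then show ?thesis using v0(2)[of v] that by (simp add: pos_le_divide_eq)
    next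
      case False
      then have "c v0 / a v0 * a v \<le> 0" using v0(1) c by (intro mult_nonneg_nonpos) auto
      then show ?thesis using c[OF that] by linarith
    qed
  qed
qed

definition nonneg_comb :: "'a::real_vector set \<Rightarrow> 'a set" where
  "nonneg_comb V = {x. \<exists>c. (\<forall>v\<in>V. c v \<ge> 0) \<and> x = (\<Sum>v\<in>V. c v *\<^sub>R v)}"

text \<open>For finite \<open>V\<close> this is the relative interior of the cone
  \<open>nonneg_comb V\<close>, in an algebraic form.\<close>

definition pos_comb :: "'a::real_vector set \<Rightarrow> 'a set" where
  "pos_comb V = {x. \<exists>c. (\<forall>v\<in>V. c v > 0) \<and> x = (\<Sum>v\<in>V. c v *\<^sub>R v)}"

lemma nonneg_combI: "(\<And>v. v \<in> V \<Longrightarrow> c v \<ge> 0) \<Longrightarrow> (\<Sum>v\<in>V. c v *\<^sub>R v) \<in> nonneg_comb V"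
  unfolding nonneg_comb_def by blast

lemma pos_combI: "(\<And>v. v \<in> V \<Longrightarrow> c v > 0) \<Longrightarrow> (\<Sum>v\<in>V. c v *\<^sub>R v) \<in> pos_comb V"
  unfolding pos_comb_def by blast

lemma pos_comb_subset: "pos_comb V \<subseteq> nonneg_comb V"
  unfolding pos_comb_def nonneg_comb_def using less_imp_le by blast

lemma nonneg_comb_add: "x \<in> nonneg_comb V \<Longrightarrow> y \<in> nonneg_comb V \<Longrightarrow> x + y \<in> nonneg_comb V"
  unfolding nonneg_comb_def
proof clarsimp
  fix a c :: "'a \<Rightarrow> real" assume "\<forall>v\<in>V. 0 \<le> a v" "\<forall>v\<in>V. 0 \<le> c v"
  then show "\<exists>d. (\<forall>v\<in>V. 0 \<le> d v) \<and> (\<Sum>v\<in>V. a v *\<^sub>R v) + (\<Sum>v\<in>V. c v *\<^sub>R v) = (\<Sum>v\<in>V. d v *\<^sub>R v)"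
    by (intro exI[of _ "\<lambda>v. a v + c v"]) (simp add: scaleR_left_distrib sum.distrib)
qed

lemma pos_comb_add_nonneg_comb:
  assumes "x \<in> pos_comb V" "y \<in> nonneg_comb V" shows "x + y \<in> pos_comb V"
proof -
  obtain a c where "\<forall>v\<in>V. a v > 0" "x = (\<Sum>v\<in>V. a v *\<^sub>R v)" "\<forall>v\<in>V. c v \<ge> 0" "y = (\<Sum>v\<in>V. c v *\<^sub>R v)"
    using assms unfolding pos_comb_def nonneg_comb_def by blast
  then show ?thesis
    using pos_combI[of V "\<lambda>v. a v + c v"] by (simp add: scaleR_left_distrib sum.distrib add_pos_nonneg)
qed

lemma nonneg_comb_scale:
  assumes "x \<in> nonneg_comb V" "t \<ge> 0" shows "t *\<^sub>R x \<in> nonneg_comb V"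
proof -
  obtain c where "\<forall>v\<in>V. c v \<ge> 0" "x = (\<Sum>v\<in>V. c v *\<^sub>R v)"
    using assms(1) unfolding nonneg_comb_def by blast
  then show ?thesis
    using nonneg_combI[of V "\<lambda>v. t * c v"] assms(2) by (simp add: scaleR_sum_right)
qed

lemma pos_comb_scale:
  assumes "x \<in> pos_comb V" "t > 0" shows "t *\<^sub>R x \<in> pos_comb V"
proof -
  obtain c where "\<forall>v\<in>V. c v > 0" "x = (\<Sum>v\<in>V. c v *\<^sub>R v)"
    using assms(1) unfolding pos_comb_def by blast
  then show ?thesis
    using pos_combI[of V "\<lambda>v. t * c v"] assms(2) by (simp add: scaleR_sum_right)
qed

lemma nonneg_comb_mono:
  assumes "finite V" "W \<subseteq> V" shows "nonneg_comb W \<subseteq> nonneg_comb V"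
proof
  fix x assume "x \<in> nonneg_comb W"
  then obtain c where c: "\<forall>v\<in>W. c v \<ge> 0" "x = (\<Sum>v\<in>W. c v *\<^sub>R v)"
    unfolding nonneg_comb_def by blast
  have "x = (\<Sum>v\<in>V. (if v \<in> W then c v else 0) *\<^sub>R v)"
    unfolding c(2) using assms by (intro sum.mono_neutral_cong_left) auto
  then show "x \<in> nonneg_comb V"
    using nonneg_combI[of V "\<lambda>v. if v \<in> W then c v else 0"] c(1) by auto
qed

text \<open>Caratheodory's theorem for cones: moving the coefficients along a linear dependency
  until the first one vanishes discards a generator. A sign change provides the positive entry that
  the ratio test demands.\<close>

lemma nonneg_comb_independent_subset:
  assumes "finite V" "x \<in> nonneg_comb V"
  shows "\<exists>B\<subseteq>V. independent B \<and> x \<in> nonneg_comb B"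
  using assms
proof (induction V rule: finite_psubset_induct)
  case (psubset V)
  show ?case
  proof (cases "independent V")
    case True
    then show ?thesis using psubset.prems by blast
  next
    case False
    then obtain a0 where a0: "\<exists>v\<in>V. a0 v \<noteq> 0" "(\<Sum>v\<in>V. a0 v *\<^sub>R v) = 0"
      using real_vector.dependent_finite[OF psubset.hyps(1)] by blast
    obtain a w where a: "w \<in> V" "a w > (0::real)" "(\<Sum>v\<in>V. a v *\<^sub>R v) = 0"
    proof -
      obtain w where w: "w \<in> V" "a0 w \<noteq> 0" using a0 by blast
      show thesis
      proof (cases "a0 w > 0")
        case True
        then show thesis using that w a0 by blast
      next
        case False
        then show thesis using that[of w "\<lambda>v. - a0 v"] w a0(2) by (simp add: sum_negf)
      qed
    qed
    obtain c where c: "\<forall>v\<in>V. c v \<ge> 0" "x = (\<Sum>v\<in>V. c v *\<^sub>R v)"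
      using psubset.prems unfolding nonneg_comb_def by blast
    obtain t v0 where t: "v0 \<in> V" "c v0 = t * a v0" "\<And>v. v \<in> V \<Longrightarrow> c v - t * a v \<ge> 0"
      using min_ratio[OF psubset.hyps(1) a(1), of a c] a(2) c(1) by auto
    have "(\<Sum>v\<in>V. (t * a v) *\<^sub>R v) = t *\<^sub>R (\<Sum>v\<in>V. a v *\<^sub>R v)"
      by (simp add: scaleR_sum_right)
    then have "x = (\<Sum>v\<in>V. (c v - t * a v) *\<^sub>R v)"
      using a(3) by (simp add: c(2) scaleR_left_diff_distrib sum_subtractf)
    also have "\<dots> = (\<Sum>v\<in>V - {v0}. (c v - t * a v) *\<^sub>R v)"
      using t(1,2) psubset.hyps(1) by (simp add: sum.remove)
    finally have "x \<in> nonneg_comb (V - {v0})"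
      using nonneg_combI[of "V - {v0}" "\<lambda>v. c v - t * a v"] t(3) by auto
    then obtain B where "B \<subseteq> V - {v0}" "independent B" "x \<in> nonneg_comb B"
      using psubset.IH[of "V - {v0}"] t(1) by blast
    then show ?thesis by blast
  qed
qed

lemma representation_lincomb:
  assumes "independent B" "finite B" "b \<in> B"
  shows "representation B (\<Sum>v\<in>B. f v *\<^sub>R v) b = f b"
proof -
  have "representation B (\<Sum>v\<in>B. f v *\<^sub>R v) b = (\<Sum>v\<in>B. representation B (f v *\<^sub>R v) b)"
    by (subst real_vector.representation_sum[OF assms(1)])
       (auto intro: real_vector.span_base real_vector.span_scale)
  also have "\<dots> = (\<Sum>v\<in>B. if v = b then f v else 0)"
    using assms(1)
    by (intro sum.cong) (auto simp: real_vector.representation_scale real_vector.span_base real_vector.representation_basis)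
  finally show ?thesis using assms by simp
qed


section \<open>Half-open decomposition of a cone\<close>

text \<open>Phrased through \<open>Basis\<close> so that it covers the product of
  \<open>real^'n\<close> and \<open>real\<close>, where the cone over \<open>P\<close>
  lives.\<close>

definition int_points :: "'a::euclidean_space set" where
  "int_points = {x. \<forall>b\<in>Basis. x \<bullet> b \<in> \<int>}"

locale height_one_cone =
  fixes V :: "'a::euclidean_space set" and u :: 'a
  assumes finite_V: "finite V" and span_V: "span V = UNIV"
    and V_int: "V \<subseteq> int_points" and u_int: "u \<in> int_points"
    and height: "v \<in> V \<Longrightarrow> v \<bullet> u = 1"
begin

section \<open>Coordinates with respect to bases chosen among the generators\<close>

definition basis_of :: "'a set \<Rightarrow> bool" where
  "basis_of B \<longleftrightarrow> B \<subseteq> V \<and> independent B \<and> span B = UNIV"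

lemma basis_of_finite: "basis_of B \<Longrightarrow> finite B"
  unfolding basis_of_def using finite_V finite_subset by blast

lemma finite_bases: "finite {B. basis_of B}"
  by (rule finite_subset[of _ "Pow V"]) (auto simp: basis_of_def finite_V)

lemma card_basis_of: "basis_of B \<Longrightarrow> card B = DIM('a)"
  unfolding basis_of_def by (metis dim_UNIV dim_span dim_eq_card_independent)

lemma basis_ofI: "B \<subseteq> V \<Longrightarrow> independent B \<Longrightarrow> card B = DIM('a) \<Longrightarrow> basis_of B"
  unfolding basis_of_def using card_ge_dim_independent[of B UNIV] by (simp add: top.extremum_unique)

lemma sum_rep: "basis_of B \<Longrightarrow> (\<Sum>b\<in>B. representation B x b *\<^sub>R b) = x"
  using real_vector.sum_representation_eq[of B x B] basis_of_finite
  unfolding basis_of_def by simp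

lemma rep_add: "basis_of B \<Longrightarrow> representation B (x + y) b = representation B x b + representation B y b"
  unfolding basis_of_def by (simp add: real_vector.representation_add)

lemma rep_diff: "basis_of B \<Longrightarrow> representation B (x - y) b = representation B x b - representation B y b"
  unfolding basis_of_def by (simp add: real_vector.representation_diff)

lemma rep_scale: "basis_of B \<Longrightarrow> representation B (r *\<^sub>R x) b = r * representation B x b"
  unfolding basis_of_def by (simp add: real_vector.representation_scale)

lemma rep_neg: "basis_of B \<Longrightarrow> representation B (- x) b = - representation B x b"
  unfolding basis_of_def by (simp add: real_vector.representation_neg)

lemma rep_sum: "basis_of B \<Longrightarrow> representation B (\<Sum>i\<in>I. f i) b = (\<Sum>i\<in>I. representation B (f i) b)"
  unfolding basis_of_def by (simp add: real_vector.representation_sum)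

lemma rep_basis: "basis_of B \<Longrightarrow> b \<in> B \<Longrightarrow> representation B b c = (if c = b then 1 else 0)"
  unfolding basis_of_def by (simp add: real_vector.representation_basis)

lemma rep_lincomb: "basis_of B \<Longrightarrow> b \<in> B \<Longrightarrow> representation B (\<Sum>v\<in>B. f v *\<^sub>R v) b = f b"
  using representation_lincomb basis_of_finite unfolding basis_of_def by blast

lemma height_rep: "basis_of B \<Longrightarrow> (\<Sum>b\<in>B. representation B x b) = x \<bullet> u"
proof -
  assume B: "basis_of B"
  have "x \<bullet> u = (\<Sum>b\<in>B. representation B x b *\<^sub>R b) \<bullet> u" using sum_rep[OF B] by simp
  also have "\<dots> = (\<Sum>b\<in>B. representation B x b * (b \<bullet> u))" by (simp add: inner_sum_left)
  also have "\<dots> = (\<Sum>b\<in>B. representation B x b)"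
    using B by (intro sum.cong) (auto simp: basis_of_def subset_iff height)
  finally show ?thesis by simp
qed

text \<open>The linear functional that agrees with \<open>\<omega>\<close> on \<open>B\<close>. Read
  as a linear program, it is the objective value at \<open>x\<close> of the basic solution for
  \<open>B\<close>.\<close>

definition cost :: "('a \<Rightarrow> real) \<Rightarrow> 'a set \<Rightarrow> 'a \<Rightarrow> real" where
  "cost \<omega> B x = (\<Sum>b\<in>B. \<omega> b * representation B x b)"

lemma cost_basis: "basis_of B \<Longrightarrow> b \<in> B \<Longrightarrow> cost \<omega> B b = \<omega> b"
  unfolding cost_def by (simp add: rep_basis basis_of_finite if_distrib[of "\<lambda>x. _ * x"] cong: if_cong)

lemma cost_lincomb: "basis_of B \<Longrightarrow> cost \<omega> B (\<Sum>v\<in>W. f v *\<^sub>R v) = (\<Sum>v\<in>W. f v * cost \<omega> B v)"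
  unfolding cost_def
  by (simp add: rep_sum rep_scale sum_distrib_left mult.left_commute) (rule sum.swap)

text \<open>The point lies on no hyperplane spanned by all but one element of a basis, so every sign
  condition on its coordinates is strict.\<close>

definition generic_point :: "'a \<Rightarrow> bool" where
  "generic_point x \<longleftrightarrow> (\<forall>B. basis_of B \<longrightarrow> (\<forall>b\<in>B. representation B x b \<noteq> 0))"

text \<open>No reduced cost vanishes. Geometrically, no lifted point \<open>(j, \<omega> j)\<close>
  lies on the hyperplane through the lifted points of a basis not containing \<open>j\<close>, so
  the subdivision is a triangulation.\<close>

definition generic_weight :: "('a \<Rightarrow> real) \<Rightarrow> bool" where
  "generic_weight \<omega> \<longleftrightarrow> (\<forall>B. basis_of B \<longrightarrow> (\<forall>j\<in>V - B. cost \<omega> B j \<noteq> \<omega> j))"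

lemma exists_generic_weight: "\<exists>\<omega>. generic_weight \<omega>"
proof -
  \<comment> \<open>This is the reduced cost \<open>\<omega> j - cost \<omega> B j\<close> as a
    linear form in \<open>\<omega>\<close>; its coefficient at \<open>j\<close> is 1, so it is
    nonzero.\<close>
  let ?a = "\<lambda>(B, j) v. if v = j then 1 else if v \<in> B then - representation B j v else (0::real)"
  let ?F = "?a ` (SIGMA B:{B. basis_of B}. V - B)"
  have "finite ?F" using finite_bases finite_V by auto
  moreover have "\<exists>v\<in>V. a v \<noteq> 0" if "a \<in> ?F" for a using that by force
  ultimately obtain \<omega> where \<omega>: "\<forall>a\<in>?F. (\<Sum>v\<in>V. a v * \<omega> v) \<noteq> 0"
    using exists_generic_weights[of ?F V] finite_V by blast
  have "cost \<omega> B j \<noteq> \<omega> j" if B: "basis_of B" and j: "j \<in> V - B" for B j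
  proof -
    have "(\<Sum>v\<in>V. ?a (B, j) v * \<omega> v) =
        (\<Sum>v\<in>V. (if v = j then \<omega> v else 0) - (if v \<in> B then \<omega> v * representation B j v else 0))"
      using j by (intro sum.cong) auto
    also have "\<dots> = \<omega> j - (\<Sum>v\<in>V. if v \<in> B then \<omega> v * representation B j v else 0)"
      using j finite_V by (simp add: sum_subtractf)
    also have "(\<Sum>v\<in>V. if v \<in> B then \<omega> v * representation B j v else 0) = cost \<omega> B j"
      unfolding cost_def using B finite_V
      by (simp add: basis_of_def Int_absorb1 flip: sum.inter_restrict)
    finally show ?thesis using \<omega> B j by force
  qed
  then show ?thesis unfolding generic_weight_def by blast
qed

lemma generic_point_uminus: "generic_point g \<Longrightarrow> generic_point (- g)"
  by (simp add: generic_point_def rep_neg)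

lemma exists_generic_point: "\<exists>g. g \<in> pos_comb V \<and> generic_point g"
proof -
  \<comment> \<open>The coordinate at \<open>b\<close> of the point with coefficients
    \<open>c\<close>, as a linear form in \<open>c\<close>; its coefficient at \<open>b\<close> is
    1. Positive weights put the point into \<open>pos_comb V\<close>.\<close>
  let ?a = "\<lambda>(B, b) v. representation B v b"
  let ?F = "?a ` (SIGMA B:{B. basis_of B}. B)"
  have "finite ?F" using finite_bases basis_of_finite by auto
  moreover have "\<exists>v\<in>V. a v \<noteq> 0" if a: "a \<in> ?F" for a
  proof -
    obtain B b where "basis_of B" "b \<in> B" "a = ?a (B, b)" using a by auto
    then show ?thesis by (intro bexI[of _ b]) (auto simp: rep_basis basis_of_def)
  qed
  ultimately obtain c where c: "\<forall>v. c v > 0" "\<forall>a\<in>?F. (\<Sum>v\<in>V. a v * c v) \<noteq> 0"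
    using exists_generic_weights[of ?F V] finite_V by blast
  have "representation B (\<Sum>v\<in>V. c v *\<^sub>R v) b \<noteq> 0" if "basis_of B" "b \<in> B" for B b
  proof -
    have "representation B (\<Sum>v\<in>V. c v *\<^sub>R v) b = (\<Sum>v\<in>V. ?a (B, b) v * c v)"
      using that by (simp add: rep_sum rep_scale mult.commute)
    then show ?thesis using c(2) that by force
  qed
  then show ?thesis
    using c(1) pos_combI[of V c] unfolding generic_point_def by blast
qed

section \<open>Existence and uniqueness of the optimal basis at a generic point\<close>

lemma representation_eq_0_if_span_diff:
  assumes "basis_of B" "x \<in> span (B - {b})"
  shows "representation B x b = 0"
proof -
  have "representation B x = representation (B - {b}) x"
    using assms by (intro real_vector.representation_extend) (auto simp: basis_of_def)
  then show ?thesis using real_vector.representation_ne_zero[of "B - {b}" x b] by auto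
qed

text \<open>One pivot of the simplex algorithm.\<close>
lemma pivot:
  assumes B: "basis_of B" and y: "generic_point y" "\<forall>b\<in>B. representation B y b > 0"
    and j: "j \<in> V - B" "\<omega> j < cost \<omega> B j"
  shows "\<exists>B'. basis_of B' \<and> (\<forall>b\<in>B'. representation B' y b > 0) \<and> cost \<omega> B' y < cost \<omega> B y"
proof -
  define c where "c = representation B y"
  define a where "a = representation B j"
  have finB: "finite B" using B by (rule basis_of_finite)
  \<comment> \<open>All generators have height one, so the coordinates of \<open>j\<close> sum to 1
    and one of them is positive. This excludes an unbounded pivot direction.\<close>
  have "(\<Sum>b\<in>B. a b) = 1" unfolding a_def using height_rep[OF B] height j by auto
  then obtain w where "w \<in> B" "a w > 0"
    by (metis not_one_le_zero sum_nonpos not_le)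
  then obtain t b0 where t: "t \<ge> 0" "b0 \<in> B" "a b0 > 0" "c b0 = t * a b0" "\<forall>b\<in>B. c b - t * a b \<ge> 0"
    using min_ratio[OF finB, of w a c] y(2) unfolding c_def by (auto simp: less_imp_le)
  have "c b0 > 0" using y(2) t(2) by (simp add: c_def)
  then have "t > 0" using t(1,4) by (cases "t = 0") auto
  define B' where "B' = insert j (B - {b0})"
  have jB: "j \<notin> B - {b0}" using j by auto
  have B': "basis_of B'"
  proof (rule basis_ofI)
    show "B' \<subseteq> V" using B j unfolding B'_def basis_of_def by auto
    have "j \<notin> span (B - {b0})"
      using representation_eq_0_if_span_diff[OF B] t(3) unfolding a_def by fastforce
    moreover have "independent (B - {b0})"
      using B unfolding basis_of_def by (meson Diff_subset real_vector.independent_mono)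
    ultimately show "independent B'"
      unfolding B'_def by (simp add: real_vector.independent_insert)
    show "card B' = DIM('a)"
      unfolding B'_def using card_basis_of[OF B] finB t(2) jB
      by (metis card_Suc_Diff1 card_insert_disjoint finite_Diff)
  qed
  define c' where "c' b = (if b = j then t else c b - t * a b)" for b
  \<comment> \<open>The updated coefficient of the leaving element \<open>b0\<close> is 0, so a sum
    over \<open>B'\<close> may be taken over \<open>j\<close> and all of \<open>B\<close>.\<close>
  have split: "(\<Sum>b\<in>B'. f b (c' b)) = f j t + (\<Sum>b\<in>B. f b (c b - t * a b))"
    if "f b0 0 = 0" for f :: "'a \<Rightarrow> real \<Rightarrow> 'b::comm_monoid_add"
  proof -
    have "(\<Sum>b\<in>B'. f b (c' b)) = f j (c' j) + (\<Sum>b\<in>B - {b0}. f b (c' b))"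
      unfolding B'_def using jB finB by simp
    also have "(\<Sum>b\<in>B - {b0}. f b (c' b)) = (\<Sum>b\<in>B - {b0}. f b (c b - t * a b))"
      using jB by (intro sum.cong) (auto simp: c'_def)
    also have "\<dots> = (\<Sum>b\<in>B. f b (c b - t * a b))"
      using finB t(2,4) that by (simp add: sum.remove)
    finally show ?thesis by (simp add: c'_def)
  qed
  have "(\<Sum>b\<in>B'. c' b *\<^sub>R b) = t *\<^sub>R j + (\<Sum>b\<in>B. (c b - t * a b) *\<^sub>R b)"
    by (rule split) simp
  also have "(\<Sum>b\<in>B. (c b - t * a b) *\<^sub>R b) = (\<Sum>b\<in>B. c b *\<^sub>R b) - t *\<^sub>R (\<Sum>b\<in>B. a b *\<^sub>R b)"
    by (simp add: scaleR_left_diff_distrib sum_subtractf scaleR_sum_right)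
  also have "\<dots> = y - t *\<^sub>R j" unfolding c_def a_def sum_rep[OF B] ..
  finally have "(\<Sum>b\<in>B'. c' b *\<^sub>R b) = y" by simp
  then have rep: "representation B' y b = c' b" if "b \<in> B'" for b
    using rep_lincomb[OF B' that, of c'] by simp
  have "c' b \<ge> 0" if "b \<in> B'" for b
    using that t \<open>t > 0\<close> by (auto simp: c'_def B'_def)
  then have "\<forall>b\<in>B'. representation B' y b > 0"
    using rep y(1) B' unfolding generic_point_def by (metis order_le_less)
  moreover have "cost \<omega> B' y = (\<Sum>b\<in>B'. \<omega> b * c' b)"
    unfolding cost_def using rep by simp
  then have "cost \<omega> B' y = \<omega> j * t + (\<Sum>b\<in>B. \<omega> b * (c b - t * a b))"
    using split[of "\<lambda>b x. \<omega> b * x"] by simp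
  then have "cost \<omega> B' y = \<omega> j * t + (cost \<omega> B y - t * cost \<omega> B j)"
    unfolding cost_def c_def a_def by (simp add: right_diff_distrib sum_subtractf sum_distrib_left mult.left_commute)
  then have "cost \<omega> B' y < cost \<omega> B y"
    using j(2) \<open>t > 0\<close> by (simp add: mult.commute)
  ultimately show ?thesis using B' by blast
qed

text \<open>The maximal cells of the regular triangulation induced by \<open>\<omega>\<close>.\<close>
definition pieces :: "('a \<Rightarrow> real) \<Rightarrow> 'a set set" where
  "pieces \<omega> = {B. basis_of B \<and> (\<forall>j\<in>V - B. cost \<omega> B j < \<omega> j)}"

lemma finite_pieces: "finite (pieces \<omega>)"
  using finite_bases unfolding pieces_def by (rule rev_finite_subset) auto

text \<open>Caratheodory's theorem gives a basis in which \<open>y\<close> has positive coordinates.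
  Among the finitely many such bases, one of least cost admits no improving pivot, and genericity of
  \<open>\<omega>\<close> makes its optimality strict.\<close>

lemma piece_exists:
  assumes "generic_weight \<omega>" "generic_point y" "y \<in> nonneg_comb V"
  shows "\<exists>B\<in>pieces \<omega>. \<forall>b\<in>B. representation B y b > 0"
proof -
  let ?F = "{B. basis_of B \<and> (\<forall>b\<in>B. representation B y b > 0)}"
  have fin: "finite ?F" using finite_bases by (rule rev_finite_subset) auto
  obtain B0 where B0: "B0 \<subseteq> V" "independent B0" "y \<in> nonneg_comb B0"
    using nonneg_comb_independent_subset[OF finite_V assms(3)] by blast
  obtain B where B: "B0 \<subseteq> B" "B \<subseteq> V" "independent B" "V \<subseteq> span B"
    using real_vector.maximal_independent_subset_extend[OF B0(1,2)] by blast
  have "span B = UNIV" using B(4) span_V by (metis real_vector.span_mono real_vector.span_span top.extremum_uniqueI)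
  then have bB: "basis_of B" using B unfolding basis_of_def by blast
  have "y \<in> nonneg_comb B" using nonneg_comb_mono[OF basis_of_finite[OF bB] B(1)] B0(3) by blast
  then obtain c where c: "\<forall>v\<in>B. c v \<ge> 0" "y = (\<Sum>v\<in>B. c v *\<^sub>R v)" unfolding nonneg_comb_def by blast
  then have "\<forall>b\<in>B. representation B y b \<ge> 0" using rep_lincomb[OF bB] by simp
  then have "B \<in> ?F" using bB assms(2) unfolding generic_point_def by (force simp: less_le)
  then obtain M where M: "M \<in> ?F" "\<forall>B\<in>?F. cost \<omega> M y \<le> cost \<omega> B y"
    using ex_is_arg_min_if_finite[OF fin, of "\<lambda>B. cost \<omega> B y"] by (auto simp: is_arg_min_linorder)
  have "cost \<omega> M j < \<omega> j" if j: "j \<in> V - M" for j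
  proof (rule ccontr)
    assume "\<not> cost \<omega> M j < \<omega> j"
    moreover have "cost \<omega> M j \<noteq> \<omega> j"
      using assms(1) j M(1) unfolding generic_weight_def by blast
    ultimately have "\<omega> j < cost \<omega> M j" by linarith
    then show False using pivot[of M y j \<omega>] M j assms(2) by force
  qed
  then show ?thesis using M(1) unfolding pieces_def by blast
qed

text \<open>Weak duality: the functional \<open>cost \<omega> B\<close> of a piece is at most
  \<open>\<omega>\<close> on \<open>V\<close>, with equality only on \<open>B\<close>. Comparing
  both pieces at \<open>y\<close> in both directions yields equal costs, and complementary slackness
  then forces each basis into the other.\<close>

lemma piece_unique:
  assumes "B \<in> pieces \<omega>" "B' \<in> pieces \<omega>"
    and "\<forall>b\<in>B. representation B y b > 0" "\<forall>b\<in>B'. representation B' y b > 0"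
  shows "B = B'"
proof -
  have *: "cost \<omega> B y \<le> cost \<omega> B' y \<and> (cost \<omega> B y = cost \<omega> B' y \<longrightarrow> B' \<subseteq> B)"
    if B: "B \<in> pieces \<omega>" and B': "B' \<in> pieces \<omega>" and pos: "\<forall>b\<in>B'. representation B' y b > 0" for B B'
  proof -
    have b: "basis_of B" "basis_of B'" using B B' by (auto simp: pieces_def)
    have le: "cost \<omega> B b \<le> \<omega> b" if "b \<in> B'" for b
      using that B b cost_basis[OF b(1), of b \<omega>] unfolding pieces_def basis_of_def
      by (cases "b \<in> B") (auto intro: less_imp_le)
    have eq: "cost \<omega> B y = (\<Sum>b\<in>B'. representation B' y b * cost \<omega> B b)"
      using cost_lincomb[OF b(1), of \<omega> "representation B' y" B'] sum_rep[OF b(2)] by simp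
    have eq': "cost \<omega> B' y = (\<Sum>b\<in>B'. representation B' y b * \<omega> b)"
      unfolding cost_def by (simp add: mult.commute)
    have le': "cost \<omega> B y \<le> cost \<omega> B' y"
      unfolding eq eq' using pos le by (intro sum_mono mult_left_mono) (auto intro: less_imp_le)
    moreover have "b \<in> B" if "cost \<omega> B y = cost \<omega> B' y" "b \<in> B'" for b
    proof (rule ccontr)
      assume "b \<notin> B"
      then have "cost \<omega> B b < \<omega> b" using B b that unfolding pieces_def basis_of_def by blast
      then have "(\<Sum>b\<in>B'. representation B' y b * cost \<omega> B b) < (\<Sum>b\<in>B'. representation B' y b * \<omega> b)"
        using pos le that(2)
        by (intro sum_strict_mono_ex1[OF basis_of_finite[OF b(2)]] bexI[of _ b])
           (auto intro!: mult_left_mono simp: less_imp_le)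
      then show False using that(1) eq eq' by simp
    qed
    ultimately show ?thesis by blast
  qed
  show ?thesis
    using *[OF assms(1,2,4)] *[OF assms(2,1,3)] by fastforce
qed

section \<open>Half-open simplicial cones obtained by perturbation\<close>

definition half_cone :: "'a set \<Rightarrow> 'a set \<Rightarrow> 'a set" where
  "half_cone B I = {x. \<forall>b\<in>B. representation B x b > 0 \<or> representation B x b = 0 \<and> b \<in> I}"

text \<open>\<open>half_cone B I\<close> is the simplicial cone on \<open>B\<close> without the
  facets opposite to elements outside \<open>I\<close>. With this choice of \<open>I\<close> and a
  generic \<open>z\<close>, it consists of the points that enter the open cone after a small move in
  direction \<open>z\<close>.\<close>

definition positive_part :: "'a \<Rightarrow> 'a set \<Rightarrow> 'a set" where
  "positive_part z B = {b\<in>B. representation B z b > 0}"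

lemma eventually_perturb:
  fixes p q :: real assumes "q \<noteq> 0"
  shows "eventually (\<lambda>\<epsilon>. p + \<epsilon> * q \<noteq> 0 \<and> (p + \<epsilon> * q > 0 \<longleftrightarrow> p > 0 \<or> p = 0 \<and> q > 0)) (at_right 0)"
proof (cases "p = 0")
  case True
  have "eventually (\<lambda>\<epsilon>. \<epsilon> > (0::real)) (at_right 0)" by (rule eventually_at_right_less)
  then show ?thesis
    by eventually_elim (use True assms in \<open>auto simp: zero_less_mult_iff\<close>)
next
  case False
  have lim: "((\<lambda>\<epsilon>. p + \<epsilon> * q) \<longlongrightarrow> p + 0 * q) (at_right 0)" by (intro tendsto_intros)
  show ?thesis
  proof (cases "p > 0")
    case True
    then have "eventually (\<lambda>\<epsilon>. p + \<epsilon> * q > 0) (at_right 0)" using order_tendstoD(1)[OF lim, of 0] by simp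
    then show ?thesis by eventually_elim (use True in auto)
  next
    case False
    then have "eventually (\<lambda>\<epsilon>. p + \<epsilon> * q < 0) (at_right 0)" using \<open>p \<noteq> 0\<close> order_tendstoD(2)[OF lim, of 0] by simp
    then show ?thesis by eventually_elim (use False \<open>p \<noteq> 0\<close> in auto)
  qed
qed

text \<open>There are finitely many bases, so one small \<open>\<epsilon>\<close> decides membership
  in all half-open cones at once and also makes the moved point generic. Statements about generic
  points thereby transfer to arbitrary \<open>x\<close>.\<close>

lemma perturb_point:
  assumes "generic_point z"
  shows "eventually (\<lambda>\<epsilon>. generic_point (x + \<epsilon> *\<^sub>R z) \<and>
    (\<forall>B. basis_of B \<longrightarrow> ((\<forall>b\<in>B. representation B (x + \<epsilon> *\<^sub>R z) b > 0) \<longleftrightarrow>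
       x \<in> half_cone B (positive_part z B)))) (at_right 0)"
proof -
  let ?P = "\<lambda>\<epsilon> B b. representation B x b + \<epsilon> * representation B z b"
  have "eventually (\<lambda>\<epsilon>. \<forall>B\<in>{B. basis_of B}. \<forall>b\<in>B. ?P \<epsilon> B b \<noteq> 0 \<and>
      (?P \<epsilon> B b > 0 \<longleftrightarrow> representation B x b > 0 \<or> representation B x b = 0 \<and> representation B z b > 0)) (at_right 0)"
    using assms finite_bases basis_of_finite unfolding generic_point_def
    by (intro eventually_ball_finite ballI eventually_perturb) auto
  then show ?thesis
    by eventually_elim
       (auto simp: generic_point_def rep_add rep_scale half_cone_def positive_part_def)
qed

lemma half_cones_disjoint:
  assumes "generic_point z" "B \<in> pieces \<omega>" "B' \<in> pieces \<omega>"
    and "x \<in> half_cone B (positive_part z B)" "x \<in> half_cone B' (positive_part z B')"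
  shows "B = B'"
proof -
  obtain \<epsilon> where "\<forall>B. basis_of B \<longrightarrow> ((\<forall>b\<in>B. representation B (x + \<epsilon> *\<^sub>R z) b > 0) \<longleftrightarrow>
       x \<in> half_cone B (positive_part z B))"
    using eventually_happens[OF perturb_point[OF assms(1), of x]] by auto
  then show ?thesis
    using piece_unique[of B \<omega> B' "x + \<epsilon> *\<^sub>R z"] assms unfolding pieces_def by blast
qed

lemma half_cones_cover:
  assumes "generic_weight \<omega>" "generic_point z"
    and "eventually (\<lambda>\<epsilon>. x + \<epsilon> *\<^sub>R z \<in> nonneg_comb V) (at_right 0)"
  shows "\<exists>B\<in>pieces \<omega>. x \<in> half_cone B (positive_part z B)"
proof -
  obtain \<epsilon> where "generic_point (x + \<epsilon> *\<^sub>R z)" "x + \<epsilon> *\<^sub>R z \<in> nonneg_comb V"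
    "\<forall>B. basis_of B \<longrightarrow> ((\<forall>b\<in>B. representation B (x + \<epsilon> *\<^sub>R z) b > 0) \<longleftrightarrow>
       x \<in> half_cone B (positive_part z B))"
    using eventually_happens[OF eventually_conj[OF perturb_point[OF assms(2), of x] assms(3)]] by auto
  then show ?thesis
    using piece_exists[OF assms(1), of "x + \<epsilon> *\<^sub>R z"] unfolding pieces_def by blast
qed

lemma half_cone_nonneg:
  assumes "basis_of B" "x \<in> half_cone B I" shows "x \<in> nonneg_comb V"
proof -
  have "(\<Sum>b\<in>B. representation B x b *\<^sub>R b) \<in> nonneg_comb B"
    using assms(2) by (intro nonneg_combI) (force simp: half_cone_def)
  then show ?thesis
    using sum_rep[OF assms(1)] nonneg_comb_mono[of V B] finite_V assms(1) unfolding basis_of_def by auto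
qed

lemma nonneg_comb_eq_half_cones:
  assumes "generic_weight \<omega>" "generic_point g" "g \<in> pos_comb V"
  shows "nonneg_comb V = (\<Union>B\<in>pieces \<omega>. half_cone B (positive_part g B))"
proof (intro equalityI subsetI)
  fix x assume x: "x \<in> nonneg_comb V"
  have "eventually (\<lambda>\<epsilon>. \<epsilon> > (0::real)) (at_right 0)" by (rule eventually_at_right_less)
  then have "eventually (\<lambda>\<epsilon>. x + \<epsilon> *\<^sub>R g \<in> nonneg_comb V) (at_right 0)"
    by eventually_elim
       (use x assms(3) pos_comb_subset in \<open>auto intro!: nonneg_comb_add nonneg_comb_scale\<close>)
  then show "x \<in> (\<Union>B\<in>pieces \<omega>. half_cone B (positive_part g B))"
    using half_cones_cover[OF assms(1,2)] by blast
next
  fix x assume "x \<in> (\<Union>B\<in>pieces \<omega>. half_cone B (positive_part g B))"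
  then show "x \<in> nonneg_comb V" using half_cone_nonneg unfolding pieces_def by blast
qed

text \<open>A small step against an interior direction stays in the cone if all coefficients are
  positive. Conversely, a point of the cone plus a positive multiple of \<open>g\<close> has
  positive coefficients. Thus the direction \<open>- g\<close> removes exactly the boundary, while
  \<open>g\<close> keeps it.\<close>

lemma pos_comb_eq_half_cones:
  assumes "generic_weight \<omega>" "generic_point g" "g \<in> pos_comb V"
  shows "pos_comb V = (\<Union>B\<in>pieces \<omega>. half_cone B (positive_part (- g) B))"
proof (intro equalityI subsetI)
  fix x assume "x \<in> pos_comb V"
  then obtain a where a: "\<forall>v\<in>V. a v > 0" "x = (\<Sum>v\<in>V. a v *\<^sub>R v)" unfolding pos_comb_def by blast
  obtain c where c: "\<forall>v\<in>V. c v > 0" "g = (\<Sum>v\<in>V. c v *\<^sub>R v)" using assms(3) unfolding pos_comb_def by blast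
  have "eventually (\<lambda>\<epsilon>. \<forall>v\<in>V. a v - \<epsilon> * c v > 0) (at_right 0)"
  proof (intro eventually_ball_finite[OF finite_V] ballI)
    fix v assume v: "v \<in> V"
    have lim: "((\<lambda>\<epsilon>. a v - \<epsilon> * c v) \<longlongrightarrow> a v - 0 * c v) (at_right 0)" by (intro tendsto_intros)
    show "eventually (\<lambda>\<epsilon>. a v - \<epsilon> * c v > 0) (at_right 0)" using order_tendstoD(1)[OF lim, of 0] a v by simp
  qed
  then have "eventually (\<lambda>\<epsilon>. x + \<epsilon> *\<^sub>R (- g) \<in> nonneg_comb V) (at_right 0)"
  proof eventually_elim
    case (elim \<epsilon>)
    have "x + \<epsilon> *\<^sub>R (- g) = (\<Sum>v\<in>V. (a v - \<epsilon> * c v) *\<^sub>R v)"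
      by (simp add: a(2) c(2) scaleR_left_diff_distrib sum_subtractf scaleR_sum_right)
    then show ?case using elim nonneg_combI[of V "\<lambda>v. a v - \<epsilon> * c v"] by (simp add: less_imp_le)
  qed
  then show "x \<in> (\<Union>B\<in>pieces \<omega>. half_cone B (positive_part (- g) B))"
    using half_cones_cover[OF assms(1) generic_point_uminus[OF assms(2)]] by blast
next
  fix x assume "x \<in> (\<Union>B\<in>pieces \<omega>. half_cone B (positive_part (- g) B))"
  then obtain B where B: "B \<in> pieces \<omega>" "x \<in> half_cone B (positive_part (- g) B)" by blast
  obtain \<epsilon> where e: "\<epsilon> > 0" "\<forall>B. basis_of B \<longrightarrow> ((\<forall>b\<in>B. representation B (x + \<epsilon> *\<^sub>R (- g)) b > 0) \<longleftrightarrow>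
       x \<in> half_cone B (positive_part (- g) B))"
    using eventually_happens[OF eventually_conj[OF eventually_at_right_less perturb_point[OF generic_point_uminus[OF assms(2)], of x]]] by auto
  have bB: "basis_of B" using B by (simp add: pieces_def)
  then have "x + \<epsilon> *\<^sub>R (- g) \<in> half_cone B {}" using e B unfolding half_cone_def by auto
  then have "x + \<epsilon> *\<^sub>R (- g) \<in> nonneg_comb V" using half_cone_nonneg[OF bB] by blast
  then have "\<epsilon> *\<^sub>R g + (x + \<epsilon> *\<^sub>R (- g)) \<in> pos_comb V"
    using e(1) assms(3) by (intro pos_comb_add_nonneg_comb pos_comb_scale)
  then show "x \<in> pos_comb V" by simp
qed

end


section \<open>Reciprocity and Gorenstein cones\<close>

lemma int_points_add: "x \<in> int_points \<Longrightarrow> y \<in> int_points \<Longrightarrow> x + y \<in> int_points"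
  by (auto simp: int_points_def inner_add_left)

lemma int_points_diff: "x \<in> int_points \<Longrightarrow> y \<in> int_points \<Longrightarrow> x - y \<in> int_points"
  by (auto simp: int_points_def inner_diff_left)

lemma int_points_0: "0 \<in> int_points"
  by (simp add: int_points_def)

lemma int_points_sum: "(\<And>i. i \<in> A \<Longrightarrow> f i \<in> int_points) \<Longrightarrow> (\<Sum>i\<in>A. f i) \<in> int_points"
  by (induction A rule: infinite_finite_induct) (auto intro: int_points_0 int_points_add)

lemma int_points_scale: "t \<in> \<int> \<Longrightarrow> x \<in> int_points \<Longrightarrow> t *\<^sub>R x \<in> int_points"
  by (auto simp: int_points_def)

lemma int_points_inner: "x \<in> int_points \<Longrightarrow> y \<in> int_points \<Longrightarrow> x \<bullet> y \<in> \<int>"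
  by (subst euclidean_inner) (auto simp: int_points_def intro!: Ints_sum)

lemma finite_int_points_bounded:
  fixes S :: "'a::euclidean_space set"
  assumes "bounded S" shows "finite (S \<inter> int_points)"
proof -
  obtain R where R: "\<forall>x\<in>S. norm x \<le> R" using assms bounded_iff by blast
  let ?f = "\<lambda>x::'a. restrict (\<lambda>b. x \<bullet> b) Basis"
  have "?f ` (S \<inter> int_points) \<subseteq> (\<Pi>\<^sub>E b\<in>Basis. {z\<in>\<int>. \<bar>z\<bar> \<le> R})"
    using R by (fastforce simp: int_points_def intro: order_trans[OF Basis_le_norm])
  moreover have "finite (\<Pi>\<^sub>E b\<in>(Basis::'a set). {z\<in>\<int>. \<bar>z\<bar> \<le> R})"
    by (intro finite_PiE) (auto simp: finite_abs_int_segment)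
  ultimately have "finite (?f ` (S \<inter> int_points))" by (rule finite_subset)
  moreover have "inj_on ?f (S \<inter> int_points)"
    by (rule inj_onI) (metis euclidean_eqI restrict_apply')
  ultimately show ?thesis by (rule finite_imageD)
qed

context height_one_cone
begin

section \<open>Lattice points by height, and half-open boxes\<close>

definition slice :: "'a set \<Rightarrow> nat \<Rightarrow> 'a set" where
  "slice S m = {x\<in>S. x \<in> int_points \<and> x \<bullet> u = real m}"

definition gf :: "'a set \<Rightarrow> int fps" where
  "gf S = Abs_fps (\<lambda>m. int (card (slice S m)))"

lemma height_nonneg: assumes "x \<in> nonneg_comb V" shows "x \<bullet> u \<ge> 0"
proof -
  obtain c where "\<forall>v\<in>V. c v \<ge> 0" "x = (\<Sum>v\<in>V. c v *\<^sub>R v)" using assms unfolding nonneg_comb_def by blast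
  then show ?thesis by (auto simp: inner_sum_left height intro!: sum_nonneg)
qed

lemma finite_slice: assumes "S \<subseteq> nonneg_comb V" shows "finite (slice S m)"
proof -
  have "norm x \<le> real m * (\<Sum>v\<in>V. norm v)" if x: "x \<in> slice S m" for x
  proof -
    obtain c where c: "\<forall>v\<in>V. c v \<ge> 0" "x = (\<Sum>v\<in>V. c v *\<^sub>R v)"
      using x assms unfolding slice_def nonneg_comb_def by blast
    have "(\<Sum>v\<in>V. c v) = real m" using x c by (simp add: slice_def inner_sum_left height)
    then have "c v \<le> real m" if "v \<in> V" for v
      using that c(1) member_le_sum[of v V c] finite_V by simp
    then have "norm x \<le> (\<Sum>v\<in>V. real m * norm v)"
      unfolding c(2) using c(1) by (intro order_trans[OF norm_sum] sum_mono) (auto intro: mult_right_mono)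
    then show ?thesis by (simp add: sum_distrib_left)
  qed
  then have "bounded (slice S m)" unfolding bounded_iff by blast
  then have "finite (slice S m \<inter> int_points)" by (rule finite_int_points_bounded)
  then show ?thesis by (rule rev_finite_subset) (auto simp: slice_def)
qed

text \<open>For \<open>b \<in> A\<close> the coordinate runs over [0,1) if \<open>b \<in> I\<close>
  and over (0,1] otherwise. Enlarging \<open>A\<close> interpolates between the half-open cone and a
  half-open fundamental box.\<close>

definition semibox :: "'a set \<Rightarrow> 'a set \<Rightarrow> 'a set \<Rightarrow> 'a set" where
  "semibox B I A = {x\<in>half_cone B I. \<forall>b\<in>A. representation B x b < 1 \<or> representation B x b = 1 \<and> b \<notin> I}"

lemma semibox_nonneg: "basis_of B \<Longrightarrow> semibox B I A \<subseteq> nonneg_comb V"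
  using half_cone_nonneg unfolding semibox_def by blast

text \<open>Peeling off the first layer in direction \<open>b\<close> leaves a translate by
  \<open>b\<close> of the whole set. Since \<open>b\<close> has height one, this becomes
  multiplication by \<open>1 - fps_X\<close> on generating functions.\<close>

lemma semibox_split:
  assumes B: "basis_of B" and b: "b \<in> B" "b \<notin> A"
  shows "semibox B I A = semibox B I (insert b A) \<union> (+) b ` semibox B I A"
    and "semibox B I (insert b A) \<inter> (+) b ` semibox B I A = {}"
proof -
  have rep: "representation B (x + b) c = representation B x c + (if c = b then 1 else 0)"
    "representation B (b + x) c = representation B x c + (if c = b then 1 else 0)"
    "representation B (x - b) c = representation B x c - (if c = b then 1 else 0)" for x c
    using B b by (auto simp: rep_add rep_diff rep_basis)
  have "x - b \<in> semibox B I A" if "x \<in> semibox B I A" "x \<notin> semibox B I (insert b A)" for x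
    using that b by (fastforce simp: semibox_def half_cone_def rep)
  then have "x \<in> (+) b ` semibox B I A" if "x \<in> semibox B I A" "x \<notin> semibox B I (insert b A)" for x
    using that by (intro image_eqI[of _ _ "x - b"]) auto
  moreover have "b + x \<in> semibox B I A" if "x \<in> semibox B I A" for x
    using that b by (fastforce simp: semibox_def half_cone_def rep)
  ultimately show "semibox B I A = semibox B I (insert b A) \<union> (+) b ` semibox B I A"
    by (auto simp: semibox_def)
  show "semibox B I (insert b A) \<inter> (+) b ` semibox B I A = {}"
    using b by (fastforce simp: semibox_def half_cone_def rep)
qed

lemma slice_translate:
  assumes "b \<in> int_points" "b \<bullet> u = real k"
  shows "slice ((+) b ` S) (m + k) = (+) b ` slice S m"
proof -
  have "x \<in> int_points" if "b + x \<in> int_points" for x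
    using int_points_diff[OF that assms(1)] by simp
  then show ?thesis using assms by (auto simp: slice_def inner_add_left intro: int_points_add)
qed

lemma gf_semibox_insert:
  assumes B: "basis_of B" and b: "b \<in> B" "b \<notin> A"
  shows "gf (semibox B I A) * (1 - fps_X) = gf (semibox B I (insert b A))"
proof (rule fps_ext)
  fix m
  have bV: "b \<in> V" "b \<in> int_points" using B b V_int by (auto simp: basis_of_def)
  have un: "slice (semibox B I A) m = slice (semibox B I (insert b A)) m \<union> slice ((+) b ` semibox B I A) m"
    by (subst semibox_split(1)[OF B b]) (auto simp: slice_def)
  have dis: "slice (semibox B I (insert b A)) m \<inter> slice ((+) b ` semibox B I A) m = {}"
    using semibox_split(2)[OF B b] by (auto simp: slice_def)
  have fin: "finite (slice (semibox B I A) m)" for A using finite_slice semibox_nonneg[OF B] by blast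
  have card: "card (slice (semibox B I A) m) =
      card (slice (semibox B I (insert b A)) m) + card (slice ((+) b ` semibox B I A) m)"
    unfolding un using fin[of A] dis by (intro card_Un_disjoint) (auto simp: un)
  \<comment> \<open>The translate starts at height one, which accounts for the separate value at
    \<open>m = 0\<close>.\<close>
  have tr: "card (slice ((+) b ` semibox B I A) m) =
      (if m = 0 then 0 else card (slice (semibox B I A) (m - 1)))"
  proof (cases m)
    case 0
    have "slice ((+) b ` semibox B I A) 0 = {}"
      using height_nonneg semibox_nonneg[OF B] height[OF bV(1)] by (fastforce simp: slice_def inner_add_left)
    then show ?thesis using 0 by simp
  next
    case (Suc n)
    then show ?thesis using slice_translate[OF bV(2), of 1 "semibox B I A" n] height[OF bV(1)]
      by (simp add: card_image)
  qed
  show "fps_nth (gf (semibox B I A) * (1 - fps_X)) m = fps_nth (gf (semibox B I (insert b A))) m"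
    using card tr by (simp add: right_diff_distrib gf_def)
qed

definition half_open_box :: "'a set \<Rightarrow> 'a set \<Rightarrow> 'a set" where
  "half_open_box B I = semibox B I B"

lemma gf_half_cone:
  assumes B: "basis_of B" shows "gf (half_cone B I) * (1 - fps_X) ^ DIM('a) = gf (half_open_box B I)"
proof -
  have "gf (half_cone B I) * (1 - fps_X) ^ card A = gf (semibox B I A)" if "finite A" "A \<subseteq> B" for A
    using that
  proof (induction A rule: finite_induct)
    case empty
    then show ?case by (simp add: semibox_def)
  next
    case (insert b A)
    then have "gf (half_cone B I) * (1 - fps_X) ^ card A * (1 - fps_X) = gf (semibox B I (insert b A))"
      using gf_semibox_insert[OF B, of b A I] by simp
    moreover have "card (insert b A) = Suc (card A)" using insert.hyps by simp
    ultimately show ?case by (simp only: power_Suc2 mult.assoc)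
  qed
  from this[of B] show ?thesis using basis_of_finite[OF B] card_basis_of[OF B] by (simp add: half_open_box_def)
qed

text \<open>The reflection sends each coordinate \<open>c\<close> to \<open>1 - c\<close>, which
  exchanges [0,1) and (0,1], hence \<open>I\<close> and its complement. The image has height
  \<open>DIM('a) - k\<close>, and its nonnegativity bounds \<open>k\<close>.\<close>

lemma half_open_box_reflect:
  assumes B: "basis_of B" and I: "I \<subseteq> B" and x: "x \<in> slice (half_open_box B I) k"
  shows "k \<le> DIM('a) \<and> (\<Sum>b\<in>B. b) - x \<in> slice (half_open_box B (B - I)) (DIM('a) - k)"
proof -
  let ?s = "\<Sum>b\<in>B. b"
  have rep_s: "representation B ?s b = 1" if "b \<in> B" for b
    using rep_lincomb[OF B that, of "\<lambda>_. 1"] by simp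
  have rep: "representation B (?s - x) b = 1 - representation B x b" if "b \<in> B" for b
    using rep_diff[OF B] rep_s[OF that] by simp
  have mem: "?s - x \<in> half_open_box B (B - I)"
    using x unfolding half_open_box_def semibox_def half_cone_def slice_def by (auto simp: rep)
  have "(\<Sum>b\<in>B. b \<bullet> u) = (\<Sum>b\<in>B. 1)"
    using B by (intro sum.cong) (auto simp: height basis_of_def)
  then have h: "(?s - x) \<bullet> u = real DIM('a) - real k"
    using x card_basis_of[OF B] by (simp add: slice_def inner_diff_left inner_sum_left)
  moreover have "(?s - x) \<bullet> u \<ge> 0"
    using mem semibox_nonneg[OF B] height_nonneg unfolding half_open_box_def by blast
  ultimately have "k \<le> DIM('a)" by simp
  moreover have "?s \<in> int_points" using B V_int by (intro int_points_sum) (auto simp: basis_of_def)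
  then have "?s - x \<in> int_points" using x by (auto simp: slice_def intro: int_points_diff)
  ultimately show ?thesis using mem h by (auto simp: slice_def)
qed

lemma card_half_open_box_reflect:
  assumes B: "basis_of B" and I: "I \<subseteq> B" and k: "k \<le> DIM('a)"
  shows "card (slice (half_open_box B (B - I)) k) = card (slice (half_open_box B I) (DIM('a) - k))"
proof (rule bij_betw_same_card)
  have *: "B - (B - I) = I" using I by auto
  let ?f = "\<lambda>x. (\<Sum>b\<in>B. b) - x"
  show "bij_betw ?f (slice (half_open_box B (B - I)) k) (slice (half_open_box B I) (DIM('a) - k))"
  proof (rule bij_betw_byWitness[of _ ?f])
    show "?f ` slice (half_open_box B (B - I)) k \<subseteq> slice (half_open_box B I) (DIM('a) - k)"
      using half_open_box_reflect[OF B, of "B - I" _ k] * by auto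
    show "?f ` slice (half_open_box B I) (DIM('a) - k) \<subseteq> slice (half_open_box B (B - I)) k"
      using half_open_box_reflect[OF B I, of _ "DIM('a) - k"] k by auto
  qed simp_all
qed

lemma slice_half_open_box_empty: "basis_of B \<Longrightarrow> I \<subseteq> B \<Longrightarrow> k > DIM('a) \<Longrightarrow> slice (half_open_box B I) k = {}"
  using half_open_box_reflect[of B I _ k] by (meson equals0I not_le)

lemma gf_pieces:
  assumes S: "S = (\<Union>B\<in>pieces \<omega>. half_cone B (positive_part z B))" and z: "generic_point z"
  shows "gf S * (1 - fps_X) ^ DIM('a) = (\<Sum>B\<in>pieces \<omega>. gf (half_open_box B (positive_part z B)))"
proof -
  have "gf S = (\<Sum>B\<in>pieces \<omega>. gf (half_cone B (positive_part z B)))"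
  proof (rule fps_ext)
    fix m
    have "slice S m = (\<Union>B\<in>pieces \<omega>. slice (half_cone B (positive_part z B)) m)"
      unfolding S by (auto simp: slice_def)
    moreover have "card \<dots> = (\<Sum>B\<in>pieces \<omega>. card (slice (half_cone B (positive_part z B)) m))"
    proof (intro card_UN_disjoint finite_pieces ballI impI)
      fix B assume "B \<in> pieces \<omega>"
      then show "finite (slice (half_cone B (positive_part z B)) m)"
        using half_cone_nonneg by (intro finite_slice) (auto simp: pieces_def)
      fix B' assume "B' \<in> pieces \<omega>" "B \<noteq> B'"
      with \<open>B \<in> pieces \<omega>\<close> show "slice (half_cone B (positive_part z B)) m \<inter> slice (half_cone B' (positive_part z B')) m = {}"
        using half_cones_disjoint[OF z] by (auto simp: slice_def)
    qed
    ultimately show "fps_nth (gf S) m = fps_nth (\<Sum>B\<in>pieces \<omega>. gf (half_cone B (positive_part z B))) m"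
      by (simp add: gf_def fps_sum_nth)
  qed
  then show ?thesis
    by (simp add: sum_distrib_right gf_half_cone pieces_def)
qed

text \<open>Ehrhart--Macdonald reciprocity: perturbing by \<open>g\<close> and by \<open>- g\<close> produces complementary
  half-open boxes, and these are exchanged by a point reflection.\<close>
lemma reciprocity:
  defines "H \<equiv> gf (nonneg_comb V) * (1 - fps_X) ^ DIM('a)"
    and "H0 \<equiv> gf (pos_comb V) * (1 - fps_X) ^ DIM('a)"
  shows "k \<le> DIM('a) \<Longrightarrow> fps_nth H0 k = fps_nth H (DIM('a) - k)"
    and "k > DIM('a) \<Longrightarrow> fps_nth H k = 0" "k > DIM('a) \<Longrightarrow> fps_nth H0 k = 0"
proof -
  obtain \<omega> where \<omega>: "generic_weight \<omega>" using exists_generic_weight by blast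
  obtain g where g: "g \<in> pos_comb V" "generic_point g" using exists_generic_point by blast
  have pos: "positive_part (- g) B = B - positive_part g B" if "basis_of B" for B
    using g(2) that by (force simp: positive_part_def rep_neg generic_point_def)
  have H: "fps_nth H k = (\<Sum>B\<in>pieces \<omega>. int (card (slice (half_open_box B (positive_part g B)) k)))" for k
    unfolding H_def using gf_pieces[OF nonneg_comb_eq_half_cones[OF \<omega> g(2,1)] g(2)]
    by (simp add: fps_sum_nth gf_def)
  have H0: "fps_nth H0 k = (\<Sum>B\<in>pieces \<omega>. int (card (slice (half_open_box B (B - positive_part g B)) k)))" for k
    unfolding H0_def using gf_pieces[OF pos_comb_eq_half_cones[OF \<omega> g(2,1)] generic_point_uminus[OF g(2)]]
    by (simp add: fps_sum_nth gf_def pos pieces_def)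
  have sub: "positive_part g B \<subseteq> B" for B by (auto simp: positive_part_def)
  show "fps_nth H0 k = fps_nth H (DIM('a) - k)" if "k \<le> DIM('a)"
    unfolding H H0 using that sub by (intro sum.cong) (auto simp: card_half_open_box_reflect pieces_def)
  show "fps_nth H k = 0" "fps_nth H0 k = 0" if "k > DIM('a)"
    unfolding H H0 using that sub by (auto intro!: sum.neutral simp: slice_half_open_box_empty pieces_def)
qed

section \<open>The interior lattice point of a Gorenstein cone\<close>

lemma slice_nonneg_0: "slice (nonneg_comb V) 0 = {0}"
proof -
  have "x = 0" if x: "x \<in> slice (nonneg_comb V) 0" for x
  proof -
    obtain c where c: "\<forall>v\<in>V. c v \<ge> 0" "x = (\<Sum>v\<in>V. c v *\<^sub>R v)"
      using x unfolding slice_def nonneg_comb_def by blast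
    have "(\<Sum>v\<in>V. c v) = 0" using x c by (simp add: slice_def inner_sum_left height)
    then have "\<forall>v\<in>V. c v = 0" using c(1) finite_V by (simp add: sum_nonneg_eq_0_iff)
    then show ?thesis using c(2) by simp
  qed
  moreover have "0 \<in> nonneg_comb V" using nonneg_combI[of V "\<lambda>_. 0"] by simp
  ultimately show ?thesis by (auto simp: slice_def int_points_0)
qed

text \<open>Reciprocity and symmetry make the interior series equal to the cone series shifted by
  \<open>r = DIM('a) - d\<close>. The cone has only the origin at height 0, so the interior has
  exactly one lattice point \<open>m\<close> at height \<open>r\<close>.\<close>

lemma gorenstein_point:
  defines "H \<equiv> gf (nonneg_comb V) * (1 - fps_X) ^ DIM('a)"
  assumes deg: "fps_nth H d \<noteq> 0" "\<And>i. i > d \<Longrightarrow> fps_nth H i = 0"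
    and sym: "\<And>i. i \<le> d \<Longrightarrow> fps_nth H i = fps_nth H (d - i)"
  shows "d \<le> DIM('a)"
    and "\<exists>m\<in>pos_comb V \<inter> int_points. m \<bullet> u = real (DIM('a) - d) \<and>
           (\<forall>x\<in>pos_comb V \<inter> int_points. x - m \<in> nonneg_comb V)"
proof -
  define H0 where "H0 = gf (pos_comb V) * (1 - fps_X) ^ DIM('a)"
  define r where "r = DIM('a) - d"
  show d: "d \<le> DIM('a)" using reciprocity(2)[of d] deg(1) unfolding H_def by (meson not_le)
  have "H0 = fps_X ^ r * H"
  proof (rule fps_ext)
    fix k
    have "fps_nth H0 k = (if k < r then 0 else fps_nth H (k - r))"
    proof (cases "k \<le> DIM('a)")
      case True
      then have *: "fps_nth H0 k = fps_nth H (DIM('a) - k)"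
        using reciprocity(1) unfolding H_def H0_def by blast
      show ?thesis
      proof (cases "k < r")
        case True
        then show ?thesis using * deg(2) d unfolding r_def by simp
      next
        case False
        then have "DIM('a) - k \<le> d" "d - (DIM('a) - k) = k - r" using True d unfolding r_def by auto
        then show ?thesis using * sym[of "DIM('a) - k"] False by simp
      qed
    next
      case False
      then have "fps_nth H0 k = 0" using reciprocity(3) unfolding H0_def by simp
      moreover have "k - r > d" using False d unfolding r_def by simp
      ultimately show ?thesis using deg(2) by simp
    qed
    then show "fps_nth H0 k = fps_nth (fps_X ^ r * H) k" by (simp add: fps_X_power_mult_nth)
  qed
  then have "gf (pos_comb V) * (1 - fps_X) ^ DIM('a) = (fps_X ^ r * gf (nonneg_comb V)) * (1 - fps_X) ^ DIM('a)"
    unfolding H0_def H_def by (simp add: mult.assoc)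
  moreover have "(1 - fps_X :: int fps) ^ DIM('a) \<noteq> 0"
  proof -
    have "fps_nth (1 - fps_X :: int fps) 0 \<noteq> 0" by simp
    then have "(1 - fps_X :: int fps) \<noteq> 0" by force
    then show ?thesis by simp
  qed
  ultimately have eq: "gf (pos_comb V) = fps_X ^ r * gf (nonneg_comb V)" by simp
  have "int (card (slice (pos_comb V) m)) = (if m < r then 0 else int (card (slice (nonneg_comb V) (m - r))))" for m
    using arg_cong[OF eq, of "\<lambda>f. fps_nth f m"] by (simp add: fps_X_power_mult_nth gf_def)
  then have cards: "card (slice (pos_comb V) m) = (if m < r then 0 else card (slice (nonneg_comb V) (m - r)))" for m
    by (metis (mono_tags) of_nat_0 of_nat_eq_iff)
  have "card (slice (pos_comb V) r) = 1" using cards[of r] slice_nonneg_0 by simp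
  then obtain m where "m \<in> slice (pos_comb V) r" by (metis card_1_singletonE insertI1)
  then have m: "m \<in> pos_comb V" "m \<in> int_points" "m \<bullet> u = real r" by (auto simp: slice_def)
  have "x - m \<in> nonneg_comb V" if x: "x \<in> pos_comb V" "x \<in> int_points" for x
  proof -
    have "x \<bullet> u \<ge> 0" "x \<bullet> u \<in> \<int>"
      using x height_nonneg pos_comb_subset int_points_inner u_int by blast+
    then obtain k where "x \<bullet> u = real k" by (metis Ints_cases nonneg_int_cases of_int_0_le_iff of_int_of_nat_eq)
    then have xk: "x \<in> slice (pos_comb V) k" using x by (simp add: slice_def)
    have fin: "finite (slice (pos_comb V) k)" by (rule finite_slice[OF pos_comb_subset])
    have "k \<ge> r" using cards[of k] xk fin by (metis card_0_eq empty_iff not_le)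
    \<comment> \<open>Translation by \<open>m\<close> is injective and lands in the interior; equal
      finite cardinalities make it onto.\<close>
    have "(+) m ` slice (nonneg_comb V) (k - r) = slice (pos_comb V) k"
    proof (rule card_subset_eq[OF fin])
      show "(+) m ` slice (nonneg_comb V) (k - r) \<subseteq> slice (pos_comb V) k"
        using m \<open>k \<ge> r\<close> by (auto simp: slice_def inner_add_left intro: int_points_add pos_comb_add_nonneg_comb)
      show "card ((+) m ` slice (nonneg_comb V) (k - r)) = card (slice (pos_comb V) k)"
        using cards[of k] \<open>k \<ge> r\<close> by (simp add: card_image)
    qed
    then obtain y where "x = m + y" "y \<in> nonneg_comb V"
      using xk unfolding slice_def by blast
    then show ?thesis by simp
  qed
  then show "\<exists>m\<in>pos_comb V \<inter> int_points. m \<bullet> u = real (DIM('a) - d) \<and>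
           (\<forall>x\<in>pos_comb V \<inter> int_points. x - m \<in> nonneg_comb V)"
    using m unfolding r_def by blast
qed

end


section \<open>Decomposing the unit of the dual cone\<close>

text \<open>A list counts the summands with multiplicity.\<close>

lemma exists_list_of_multiples:
  fixes k :: "'a::real_vector \<Rightarrow> nat"
  assumes "finite B"
  shows "\<exists>ys. set ys \<subseteq> B \<and> sum_list ys = (\<Sum>b\<in>B. real (k b) *\<^sub>R b) \<and> length ys = (\<Sum>b\<in>B. k b)"
  using assms
proof (induction B rule: finite_induct)
  case empty
  then show ?case by simp
next
  case (insert b B)
  then obtain ys where "set ys \<subseteq> B" "sum_list ys = (\<Sum>b\<in>B. real (k b) *\<^sub>R b)" "length ys = (\<Sum>b\<in>B. k b)"
    by blast
  moreover have "sum_list (replicate n b) = real n *\<^sub>R b" for n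
    by (induction n) (simp_all add: scaleR_left_distrib)
  ultimately show ?case
    using insert.hyps by (intro exI[of _ "replicate (k b) b @ ys"]) auto
qed

locale gorenstein_cone = height_one_cone +
  fixes m :: 'a
  assumes m_pos: "m \<in> pos_comb V" and m_int: "m \<in> int_points"
    and m_least: "\<And>x. x \<in> pos_comb V \<Longrightarrow> x \<in> int_points \<Longrightarrow> x - m \<in> nonneg_comb V"
begin

section \<open>The dual cone and the integrality of its slice\<close>

definition dual_cone :: "'a set" where
  "dual_cone = {y. \<forall>v\<in>V. 0 \<le> y \<bullet> v}"

lemma dual_nonneg: assumes "y \<in> dual_cone" "x \<in> nonneg_comb V" shows "0 \<le> y \<bullet> x"
proof -
  obtain c where "\<forall>v\<in>V. c v \<ge> 0" "x = (\<Sum>v\<in>V. c v *\<^sub>R v)" using assms(2) unfolding nonneg_comb_def by blast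
  then show ?thesis using assms(1) by (auto simp: inner_sum_right dual_cone_def intro!: sum_nonneg)
qed

lemma u_dual: "u \<in> dual_cone"
  unfolding dual_cone_def by (auto simp: height inner_commute[of u])

lemma V_nonzero: "v \<in> V \<Longrightarrow> v \<noteq> 0"
  using height by fastforce

lemma V_nonempty: "V \<noteq> {}"
proof
  assume "V = {}"
  then have "(UNIV :: 'a set) = {0}" using span_V by simp
  then show False using nonempty_Basis nonzero_Basis by blast
qed

lemma dual_m_pos: assumes "\<forall>v\<in>V. 0 < y \<bullet> v" shows "0 < y \<bullet> m"
proof -
  obtain c where "\<forall>v\<in>V. c v > 0" "m = (\<Sum>v\<in>V. c v *\<^sub>R v)" using m_pos unfolding pos_comb_def by blast
  then show ?thesis using assms V_nonempty finite_V by (auto simp: inner_sum_right intro!: sum_pos)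
qed

definition dual_slice :: "'a set" where
  "dual_slice = {y \<in> dual_cone. y \<bullet> m = 1}"

lemma dual_slice_halfspaces: "dual_slice = (\<Inter>v\<in>V. {y. v \<bullet> y \<ge> 0}) \<inter> {y. m \<bullet> y = 1}"
  by (auto simp: dual_slice_def dual_cone_def inner_commute)

lemma convex_dual_slice: "convex dual_slice"
  unfolding dual_slice_halfspaces
  by (intro convex_Int convex_INT convex_halfspace_ge convex_hyperplane)

text \<open>Since \<open>m\<close> has positive coefficients \<open>c v\<close>, the equation
  \<open>y \<bullet> m = 1\<close> bounds each \<open>y \<bullet> v\<close> by
  \<open>1 / c v\<close>; the generators span, so \<open>y\<close> is bounded in every
  direction.\<close>

lemma bounded_dual_slice: "bounded dual_slice"
proof -
  obtain c where c: "\<forall>v\<in>V. c v > 0" "m = (\<Sum>v\<in>V. c v *\<^sub>R v)" using m_pos unfolding pos_comb_def by blast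
  have yv: "0 \<le> y \<bullet> v" "y \<bullet> v \<le> 1 / c v" if y: "y \<in> dual_slice" and v: "v \<in> V" for y v
  proof -
    show y0: "0 \<le> y \<bullet> v" using y v by (simp add: dual_slice_def dual_cone_def)
    have "c v * (y \<bullet> v) \<le> (\<Sum>v\<in>V. c v * (y \<bullet> v))"
      using y c(1) v finite_V
      by (intro member_le_sum) (auto simp: dual_slice_def dual_cone_def less_imp_le)
    also have "\<dots> = y \<bullet> m" by (simp add: c(2) inner_sum_right)
    also have "\<dots> = 1" using y by (simp add: dual_slice_def)
    finally show "y \<bullet> v \<le> 1 / c v" using c(1) v by (simp add: field_simps)
  qed
  have "\<exists>K. \<forall>y\<in>dual_slice. \<bar>y \<bullet> x\<bar> \<le> K" for x
  proof -
    have "x \<in> span V" using span_V by simp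
    then obtain a where a: "x = (\<Sum>v\<in>V. a v *\<^sub>R v)" using real_vector.span_finite[OF finite_V] by auto
    have "\<bar>y \<bullet> x\<bar> \<le> (\<Sum>v\<in>V. \<bar>a v\<bar> * (1 / c v))" if y: "y \<in> dual_slice" for y
    proof -
      have "\<bar>y \<bullet> x\<bar> \<le> (\<Sum>v\<in>V. \<bar>a v * (y \<bullet> v)\<bar>)" unfolding a by (simp add: inner_sum_right sum_abs)
      also have "\<dots> \<le> (\<Sum>v\<in>V. \<bar>a v\<bar> * (1 / c v))"
        unfolding abs_mult using yv[OF y] by (intro sum_mono mult_left_mono) auto
      finally show ?thesis .
    qed
    then show ?thesis by blast
  qed
  then obtain K where K: "\<And>x y. y \<in> dual_slice \<Longrightarrow> \<bar>y \<bullet> x\<bar> \<le> K x" by metis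
  have "norm y \<le> (\<Sum>b\<in>Basis. K b)" if "y \<in> dual_slice" for y
    using K[OF that] by (intro order_trans[OF norm_le_l1 sum_mono]) auto
  then show ?thesis unfolding bounded_iff by blast
qed

lemma compact_dual_slice: "compact dual_slice"
  unfolding compact_eq_bounded_closed
proof
  show "closed dual_slice"
    unfolding dual_slice_halfspaces
    by (intro closed_Int closed_INT ballI closed_halfspace_ge closed_hyperplane)
qed (rule bounded_dual_slice)

lemma exists_small_perturbation:
  assumes "\<forall>v\<in>W. 0 < y \<bullet> v" "W \<subseteq> V"
  shows "\<exists>\<epsilon>>0. \<forall>v\<in>W. 0 < (y + \<epsilon> *\<^sub>R a) \<bullet> v \<and> 0 < (y - \<epsilon> *\<^sub>R a) \<bullet> v"
proof -
  have "eventually (\<lambda>\<epsilon>. \<forall>v\<in>W. 0 < (y + \<epsilon> *\<^sub>R a) \<bullet> v \<and> 0 < (y - \<epsilon> *\<^sub>R a) \<bullet> v) (at_right 0)"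
  proof (intro eventually_ball_finite ballI eventually_conj)
    show "finite W" using assms(2) finite_V finite_subset by blast
    fix v assume v: "v \<in> W"
    have l1: "((\<lambda>\<epsilon>. (y + \<epsilon> *\<^sub>R a) \<bullet> v) \<longlongrightarrow> (y + 0 *\<^sub>R a) \<bullet> v) (at_right 0)" by (intro tendsto_intros)
    show "eventually (\<lambda>\<epsilon>. 0 < (y + \<epsilon> *\<^sub>R a) \<bullet> v) (at_right 0)"
      using order_tendstoD(1)[OF l1, of 0] assms(1) v by simp
    have l2: "((\<lambda>\<epsilon>. (y - \<epsilon> *\<^sub>R a) \<bullet> v) \<longlongrightarrow> (y - 0 *\<^sub>R a) \<bullet> v) (at_right 0)" by (intro tendsto_intros)
    show "eventually (\<lambda>\<epsilon>. 0 < (y - \<epsilon> *\<^sub>R a) \<bullet> v) (at_right 0)"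
      using order_tendstoD(1)[OF l2, of 0] assms(1) v by simp
  qed
  from eventually_happens[OF eventually_conj[OF eventually_at_right_less this]]
  show ?thesis by auto
qed

text \<open>A nonzero \<open>a\<close> orthogonal to \<open>m\<close> and to the generators on which
  \<open>y\<close> vanishes could be added to and subtracted from \<open>y\<close> in a small
  amount, making \<open>y\<close> a midpoint within the slice. So \<open>m\<close> and these
  generators span, and \<open>y \<bullet> z = 0\<close> removes the component along
  \<open>m\<close>.\<close>

lemma extreme_facet_spans:
  assumes y: "y extreme_point_of dual_slice" and z: "y \<bullet> z = 0"
  shows "z \<in> span {v\<in>V. y \<bullet> v = 0}"
proof -
  let ?W = "{v\<in>V. y \<bullet> v = 0}"
  have yS: "y \<in> dual_slice" using y by (simp add: extreme_point_of_def)
  have "span (insert m ?W) = UNIV"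
  proof (rule ccontr)
    assume "span (insert m ?W) \<noteq> UNIV"
    then obtain a where a: "a \<noteq> 0" "\<forall>x\<in>span (insert m ?W). a \<bullet> x = 0"
      using span_not_UNIV_orthogonal by blast
    then have a': "a \<bullet> m = 0" "\<And>v. v \<in> ?W \<Longrightarrow> a \<bullet> v = 0" by (auto intro: real_vector.span_base)
    have "\<forall>v\<in>V - ?W. 0 < y \<bullet> v" using yS by (force simp: dual_slice_def dual_cone_def less_le)
    then obtain \<epsilon> where e: "\<epsilon> > 0" "\<forall>v\<in>V - ?W. 0 < (y + \<epsilon> *\<^sub>R a) \<bullet> v \<and> 0 < (y - \<epsilon> *\<^sub>R a) \<bullet> v"
      using exists_small_perturbation[of "V - ?W" y a] by blast
    have nn: "0 \<le> (y + \<epsilon> *\<^sub>R a) \<bullet> v \<and> 0 \<le> (y - \<epsilon> *\<^sub>R a) \<bullet> v" if "v \<in> V" for v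
    proof (cases "v \<in> ?W")
      case True
      then show ?thesis using a'(2) by (simp add: inner_add_left inner_diff_left)
    next
      case False
      then show ?thesis using e(2) that by (meson DiffI less_imp_le)
    qed
    have "y + \<epsilon> *\<^sub>R a \<in> dual_slice" "y - \<epsilon> *\<^sub>R a \<in> dual_slice"
      using yS nn a'(1) by (auto simp: dual_slice_def dual_cone_def inner_add_left inner_diff_left)
    moreover have "y \<in> open_segment (y - \<epsilon> *\<^sub>R a) (y + \<epsilon> *\<^sub>R a)"
    proof -
      have "y = midpoint (y - \<epsilon> *\<^sub>R a) (y + \<epsilon> *\<^sub>R a)" by (simp add: midpoint_def scaleR_2[symmetric])
      moreover have "y - \<epsilon> *\<^sub>R a \<noteq> y + \<epsilon> *\<^sub>R a"
      proof
        assume "y - \<epsilon> *\<^sub>R a = y + \<epsilon> *\<^sub>R a"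
        then have "(\<epsilon> + \<epsilon>) *\<^sub>R a = 0" by (simp only: scaleR_left_distrib) (simp add: algebra_simps)
        then show False using e(1) a(1) by simp
      qed
      ultimately show ?thesis by (metis midpoint_in_open_segment)
    qed
    ultimately show False using y unfolding extreme_point_of_def by blast
  qed
  then have "z \<in> span (insert m ?W)" by simp
  then obtain k where k: "z - k *\<^sub>R m \<in> span ?W" using real_vector.span_breakdown_eq by blast
  have "y \<bullet> (z - k *\<^sub>R m) = 0"
    using k by (rule real_vector.span_induct) (auto simp: subspace_def inner_add_right)
  then have "k = 0" using z yS by (simp add: inner_diff_right dual_slice_def)
  then show ?thesis using k by simp
qed

text \<open>Adding a large multiple of the sum of the generators on which \<open>y\<close> vanishes
  leaves \<open>y \<bullet> x\<close> unchanged and moves \<open>x\<close> into the interior. There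
  \<open>m_least\<close> compares the value with \<open>y \<bullet> m = 1\<close>.\<close>

lemma extreme_point_ge_1:
  assumes y: "y extreme_point_of dual_slice" and x: "x \<in> int_points" "0 < y \<bullet> x"
  shows "1 \<le> y \<bullet> x"
proof -
  let ?W = "{v\<in>V. y \<bullet> v = 0}"
  define t where "t = y \<bullet> x"
  have yS: "y \<in> dual_cone" "y \<bullet> m = 1" using y by (auto simp: extreme_point_of_def dual_slice_def)
  have finW: "finite ?W" using finite_V by simp
  have "x - t *\<^sub>R m \<in> span ?W"
    using yS by (intro extreme_facet_spans[OF y]) (simp add: inner_diff_right t_def)
  then obtain a where a: "x - t *\<^sub>R m = (\<Sum>v\<in>?W. a v *\<^sub>R v)"
    using real_vector.span_finite[OF finW] by auto
  obtain k :: nat where k: "(\<Sum>v\<in>?W. \<bar>a v\<bar>) \<le> real k" using real_arch_simple by blast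
  have ak: "a v + real k \<ge> 0" if "v \<in> ?W" for v
    using member_le_sum[of v ?W "\<lambda>v. \<bar>a v\<bar>"] that finW k by auto
  define f where "f = (\<Sum>v\<in>?W. v)"
  have "x + real k *\<^sub>R f = t *\<^sub>R m + (\<Sum>v\<in>?W. (a v + real k) *\<^sub>R v)"
    using a by (simp add: f_def scaleR_left_distrib sum.distrib scaleR_sum_right algebra_simps)
  moreover have "(\<Sum>v\<in>?W. (a v + real k) *\<^sub>R v) \<in> nonneg_comb V"
    using nonneg_combI[of ?W "\<lambda>v. a v + real k"] ak nonneg_comb_mono[OF finite_V, of ?W] by blast
  moreover have "t *\<^sub>R m \<in> pos_comb V" using x(2) m_pos pos_comb_scale unfolding t_def by blast
  ultimately have "x + real k *\<^sub>R f \<in> pos_comb V" using pos_comb_add_nonneg_comb by simp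
  moreover have "x + real k *\<^sub>R f \<in> int_points"
    using x(1) V_int unfolding f_def
    by (intro int_points_add int_points_scale int_points_sum) auto
  ultimately have "0 \<le> y \<bullet> (x + real k *\<^sub>R f - m)" using dual_nonneg[OF yS(1)] m_least by blast
  moreover have "y \<bullet> f = 0" by (simp add: f_def inner_sum_right)
  ultimately show ?thesis using yS(2) by (simp add: inner_add_right inner_diff_right)
qed

text \<open>As \<open>y\<close> has value 1 at \<open>m\<close>, subtracting a suitable integer
  multiple of \<open>m\<close> from a basis vector leaves a lattice point with value in [0,1), which
  must be 0.\<close>

lemma extreme_point_integral:
  assumes y: "y extreme_point_of dual_slice"
  shows "y \<in> int_points"
  unfolding int_points_def
proof (intro CollectI ballI)
  fix b :: 'a assume b: "b \<in> Basis"
  have bi: "b \<in> int_points" using b by (auto simp: int_points_def inner_Basis)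
  let ?x = "b - of_int \<lfloor>y \<bullet> b\<rfloor> *\<^sub>R m"
  have "y \<bullet> m = 1" using y by (auto simp: extreme_point_of_def dual_slice_def)
  then have eq: "y \<bullet> ?x = frac (y \<bullet> b)" by (simp add: inner_diff_right frac_def)
  have "?x \<in> int_points" using bi m_int by (intro int_points_diff int_points_scale) auto
  then have "\<not> 0 < y \<bullet> ?x" using extreme_point_ge_1[OF y] frac_lt_1[of "y \<bullet> b"] eq by force
  then have "frac (y \<bullet> b) = 0" using eq frac_ge_0[of "y \<bullet> b"] by linarith
  then show "y \<bullet> b \<in> \<int>" by (simp add: frac_eq_0_iff)
qed

text \<open>The dual cone is full-dimensional because \<open>u\<close> is positive on all
  generators: a vector orthogonal to the slice would be orthogonal to \<open>u\<close> and to every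
  small perturbation of \<open>u\<close>.\<close>

lemma span_extreme_points: "span {y. y extreme_point_of dual_slice} = UNIV"
proof (rule ccontr)
  let ?X = "{y. y extreme_point_of dual_slice}"
  assume "span ?X \<noteq> UNIV"
  then obtain a where a: "a \<noteq> 0" "\<forall>x\<in>span ?X. a \<bullet> x = 0"
    using span_not_UNIV_orthogonal by blast
  have "dual_slice \<subseteq> span ?X"
    using Krein_Milman_Minkowski[OF compact_dual_slice convex_dual_slice]
      convex_hull_subset_span[of ?X] by simp
  then have a0: "a \<bullet> y = 0" if "y \<in> dual_slice" for y using a(2) that by blast
  have *: "a \<bullet> y = 0" if y: "\<forall>v\<in>V. 0 < y \<bullet> v" for y
  proof -
    have "0 < y \<bullet> m" using dual_m_pos y by blast
    then have "(1 / (y \<bullet> m)) *\<^sub>R y \<in> dual_slice"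
      using y by (auto simp: dual_slice_def dual_cone_def less_imp_le)
    then have "a \<bullet> ((1 / (y \<bullet> m)) *\<^sub>R y) = 0" by (rule a0)
    then show ?thesis using \<open>0 < y \<bullet> m\<close> by simp
  qed
  have u: "\<forall>v\<in>V. 0 < u \<bullet> v" by (simp add: height inner_commute[of u])
  then obtain \<epsilon> where e: "\<epsilon> > 0" "\<forall>v\<in>V. 0 < (u + \<epsilon> *\<^sub>R a) \<bullet> v"
    using exists_small_perturbation[of V u a] by blast
  have "a \<bullet> (u + \<epsilon> *\<^sub>R a) = 0" "a \<bullet> u = 0" using * e u by blast+
  then show False using e(1) a(1) by (simp add: inner_add_right)
qed

text \<open>The independent set from Caratheodory's theorem is completed to a full basis. This makes
  the sum of \<open>B\<close> positive on every generator and gives it the value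
  \<open>DIM('a)\<close> at \<open>m\<close>, both of which the reflection argument uses.\<close>

lemma unit_in_simplicial_cone:
  obtains B where "B \<subseteq> dual_cone \<inter> int_points" "\<And>b. b \<in> B \<Longrightarrow> b \<bullet> m = 1"
    "finite B" "card B = DIM('a)" "span B = UNIV" "u \<in> nonneg_comb B"
proof -
  let ?X = "{y. y extreme_point_of dual_slice}"
  have um: "0 < u \<bullet> m" by (rule dual_m_pos) (simp add: height inner_commute[of u])
  have "(1 / (u \<bullet> m)) *\<^sub>R u \<in> dual_slice"
    using um u_dual by (auto simp: dual_slice_def dual_cone_def)
  then have "(1 / (u \<bullet> m)) *\<^sub>R u \<in> convex hull ?X"
    using Krein_Milman_Minkowski[OF compact_dual_slice convex_dual_slice] by simp
  then obtain S c where S: "finite S" "S \<subseteq> ?X" "\<forall>x\<in>S. 0 \<le> c x" "(\<Sum>v\<in>S. c v *\<^sub>R v) = (1 / (u \<bullet> m)) *\<^sub>R u"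
    unfolding convex_hull_explicit by blast
  have "(1 / (u \<bullet> m)) *\<^sub>R u \<in> nonneg_comb S"
    using nonneg_combI[of S c] S(3,4) by simp
  from nonneg_comb_scale[OF this, of "u \<bullet> m"]
  have "(u \<bullet> m) *\<^sub>R ((1 / (u \<bullet> m)) *\<^sub>R u) \<in> nonneg_comb S" using um by simp
  moreover have "(u \<bullet> m) *\<^sub>R ((1 / (u \<bullet> m)) *\<^sub>R u) = u" using um by simp
  ultimately have "u \<in> nonneg_comb S" by metis
  then obtain B0 where B0: "B0 \<subseteq> S" "independent B0" "u \<in> nonneg_comb B0"
    using nonneg_comb_independent_subset[OF S(1)] by blast
  obtain B where B: "B0 \<subseteq> B" "B \<subseteq> ?X" "independent B" "?X \<subseteq> span B"
    using real_vector.maximal_independent_subset_extend[of B0 ?X] B0 S(2) by blast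
  have span: "span B = UNIV"
    using B(4) span_extreme_points by (metis real_vector.span_mono real_vector.span_span top.extremum_uniqueI)
  have fin: "finite B" using B(3) by (rule independent_imp_finite)
  show thesis
  proof
    show "B \<subseteq> dual_cone \<inter> int_points"
      using B(2) extreme_point_integral by (auto simp: extreme_point_of_def dual_slice_def)
    show "b \<bullet> m = 1" if "b \<in> B" for b
      using B(2) that by (auto simp: extreme_point_of_def dual_slice_def)
    show "card B = DIM('a)" using span B(3) by (metis dim_UNIV dim_span dim_eq_card_independent)
    show "u \<in> nonneg_comb B" using B0(3) nonneg_comb_mono[OF fin B(1)] by blast
  qed (use fin span in auto)
qed

text \<open>Round down the coordinates of \<open>u\<close> in a simplicial subcone of the dual cone. The remainder is a
  box point; its reflection is an interior lattice point of the dual cone, so it lies at height at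
  least that of \<open>u\<close>, which bounds the height of the remainder by \<open>d\<close>.\<close>
lemma unit_decomposition:
  assumes hm: "m \<bullet> u = real (DIM('a) - d)" and d: "d \<le> DIM('a)"
  shows "\<exists>ys. set ys \<subseteq> dual_cone \<inter> int_points - {0} \<and> sum_list ys = u \<and>
           DIM('a) \<le> length ys + (2 * d - 1)"
proof -
  obtain B where B: "B \<subseteq> dual_cone \<inter> int_points" "\<And>b. b \<in> B \<Longrightarrow> b \<bullet> m = 1"
    "finite B" "card B = DIM('a)" "span B = UNIV" "u \<in> nonneg_comb B"
    using unit_in_simplicial_cone by blast
  obtain c where c: "\<forall>b\<in>B. c b \<ge> 0" "u = (\<Sum>b\<in>B. c b *\<^sub>R b)"
    using B(6) unfolding nonneg_comb_def by blast
  define k where "k b = nat \<lfloor>c b\<rfloor>" for b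
  have k: "real (k b) = of_int \<lfloor>c b\<rfloor>" if "b \<in> B" for b using c(1) that by (simp add: k_def)
  have ck: "c b = real (k b) + frac (c b)" if "b \<in> B" for b using k[OF that] by (simp add: frac_def)
  define w where "w = (\<Sum>b\<in>B. frac (c b) *\<^sub>R b)"
  have "u = (\<Sum>b\<in>B. (real (k b) + frac (c b)) *\<^sub>R b)"
    unfolding c(2) using ck by (intro sum.cong) auto
  then have uw: "u = (\<Sum>b\<in>B. real (k b) *\<^sub>R b) + w"
    by (simp add: w_def scaleR_left_distrib sum.distrib)
  have "(\<Sum>b\<in>B. real (k b) *\<^sub>R b) \<in> int_points"
    using B(1) by (intro int_points_sum int_points_scale) auto
  then have w_int: "w \<in> int_points"
    using int_points_diff[OF u_int] uw by (metis add_diff_cancel_left')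
  have w_dual: "w \<in> dual_cone"
    using B(1) by (auto simp: dual_cone_def w_def inner_sum_left frac_ge_0 subset_iff intro!: sum_nonneg mult_nonneg_nonneg)
  define x where "x = (\<Sum>b\<in>B. b) - w"
  have x_alt: "x = (\<Sum>b\<in>B. (1 - frac (c b)) *\<^sub>R b)"
    by (simp add: x_def w_def scaleR_left_diff_distrib sum_subtractf)
  have x_int: "x \<in> int_points"
    unfolding x_def using B(1) w_int by (intro int_points_diff int_points_sum) auto
  \<comment> \<open>All coefficients \<open>1 - frac (c b)\<close> are positive, and some
    \<open>b\<close> is nonzero at \<open>v\<close> because \<open>B\<close> spans; hence
    \<open>x \<bullet> v\<close> is a positive integer.\<close>
  have "1 \<le> x \<bullet> v" if v: "v \<in> V" for v
  proof -
    have nn: "0 \<le> (1 - frac (c b)) * (b \<bullet> v)" if "b \<in> B" for b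
      using that B(1) v frac_lt_1[of "c b"] by (intro mult_nonneg_nonneg) (auto simp: dual_cone_def)
    have "\<exists>b\<in>B. b \<bullet> v \<noteq> 0"
    proof (rule ccontr)
      assume "\<not> ?thesis"
      then have "\<forall>b\<in>B. b \<bullet> v = 0" by blast
      moreover have "v \<in> span B" using B(5) by simp
      ultimately have "v \<bullet> v = 0"
        by (metis orthogonal_def orthogonal_to_span inner_commute)
      then show False using V_nonzero[OF v] by simp
    qed
    then obtain b where b: "b \<in> B" "b \<bullet> v \<noteq> 0" by blast
    then have "0 < (1 - frac (c b)) * (b \<bullet> v)"
      using nn[OF b(1)] frac_lt_1[of "c b"] by (metis diff_gt_0_iff_gt less_le mult_eq_0_iff)
    then have "0 < (\<Sum>b\<in>B. (1 - frac (c b)) * (b \<bullet> v))"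
      using nn b(1) B(3) by (intro sum_pos2[of B b]) auto
    then have "0 < x \<bullet> v" by (simp add: x_alt inner_sum_left)
    moreover have "x \<bullet> v \<in> \<int>" using x_int V_int v int_points_inner by blast
    ultimately show ?thesis by (auto elim!: Ints_cases)
  qed
  then have "x - u \<in> dual_cone"
    by (simp add: dual_cone_def inner_diff_left height inner_commute[of u])
  then have "u \<bullet> m \<le> x \<bullet> m"
    using dual_nonneg[of "x - u" m] m_pos pos_comb_subset by (force simp: inner_diff_left)
  also have "x \<bullet> m = real DIM('a) - (\<Sum>b\<in>B. frac (c b))"
    using B(2,4) by (simp add: x_alt inner_sum_left sum_subtractf)
  finally have frac_le: "(\<Sum>b\<in>B. frac (c b)) \<le> real d"
    using hm d by (simp add: inner_commute of_nat_diff)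
  have "u \<bullet> m = (\<Sum>b\<in>B. real (k b)) + (\<Sum>b\<in>B. frac (c b))"
    unfolding uw using B(2) by (simp add: w_def inner_sum_left inner_add_left)
  then have sums: "real (\<Sum>b\<in>B. k b) + (\<Sum>b\<in>B. frac (c b)) = real DIM('a) - real d"
    using hm d by (simp add: inner_commute of_nat_diff)
  obtain ys where ys: "set ys \<subseteq> B" "sum_list ys = (\<Sum>b\<in>B. real (k b) *\<^sub>R b)" "length ys = (\<Sum>b\<in>B. k b)"
    using exists_list_of_multiples[OF B(3)] by blast
  have ys_dual: "set ys \<subseteq> dual_cone \<inter> int_points - {0}"
    using ys(1) B(1,2) by fastforce
  show ?thesis
  proof (cases "w = 0")
    case True
    have "(\<Sum>b\<in>B. frac (c b)) = w \<bullet> m"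
      using B(2) by (simp add: w_def inner_sum_left)
    then have "real (length ys) = real DIM('a) - real d" using True sums ys(3) by simp
    \<comment> \<open>Without remainder there are \<open>DIM('a) - d\<close> summands. For
      \<open>d = 0\<close> truncated subtraction makes the required number \<open>DIM('a)\<close>,
      which is attained.\<close>
    moreover have "real d \<le> real (2 * d - 1) \<or> d = 0" by linarith
    ultimately have "DIM('a) \<le> length ys + (2 * d - 1)" by linarith
    then show ?thesis using ys_dual ys(2) uw True by (intro exI[of _ ys]) simp
  next
    case False
    have "d \<noteq> 0"
    proof
      assume "d = 0"
      then have "\<forall>b\<in>B. frac (c b) = 0"
        using frac_le B(3) sum_nonneg_eq_0_iff[of B "\<lambda>b. frac (c b)"] sum_nonneg[of B "\<lambda>b. frac (c b)"]
        by (simp add: frac_ge_0)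
      then have "w = 0" unfolding w_def by (intro sum.neutral) (metis scaleR_zero_left)
      then show False using False by blast
    qed
    moreover have "real (length ys) \<ge> real DIM('a) - 2 * real d" using sums frac_le ys(3) by simp
    ultimately have "DIM('a) \<le> length (w # ys) + (2 * d - 1)" by auto
    then show ?thesis
      using ys_dual ys(2) uw False w_int w_dual by (intro exI[of _ "w # ys"]) auto
  qed
qed

end


section \<open>Unimodular completion and Cayley sums\<close>

text \<open>Carrying the inverse along expresses unimodularity as integrality of both maps, which
  composes easily; determinants enter only on conversion to
  \<open>lattice_affine_iso\<close>.\<close>

definition lattice_iso :: "(real^'n \<Rightarrow> real^'n) \<Rightarrow> (real^'n \<Rightarrow> real^'n) \<Rightarrow> bool" where
  "lattice_iso f g \<longleftrightarrow> linear f \<and> linear g \<and> (\<forall>x. f (g x) = x) \<and> (\<forall>x. g (f x) = x) \<and>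
     (\<forall>x. integral_vec x \<longrightarrow> integral_vec (f x)) \<and> (\<forall>x. integral_vec x \<longrightarrow> integral_vec (g x))"

lemma lattice_iso_compose:
  "lattice_iso f g \<Longrightarrow> lattice_iso f' g' \<Longrightarrow> lattice_iso (f' \<circ> f) (g \<circ> g')"
  unfolding lattice_iso_def by (auto intro: linear_compose)

lemma lattice_iso_id: "lattice_iso (\<lambda>x. x) (\<lambda>x. x)"
  unfolding lattice_iso_def by (simp add: linear_iff)

lemma integral_vec_axis: "t \<in> \<int> \<Longrightarrow> integral_vec (axis k t)"
  by (simp add: integral_vec_def axis_def)

lemma integral_vec_add: "integral_vec x \<Longrightarrow> integral_vec y \<Longrightarrow> integral_vec (x + y)"
  by (simp add: integral_vec_def)

lemma integral_vec_diff: "integral_vec x \<Longrightarrow> integral_vec y \<Longrightarrow> integral_vec (x - y)"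
  by (simp add: integral_vec_def)

lemma integral_vec_scale: "t \<in> \<int> \<Longrightarrow> integral_vec x \<Longrightarrow> integral_vec (t *\<^sub>R x)"
  by (simp add: integral_vec_def)

lemma integral_vec_inner: "integral_vec x \<Longrightarrow> integral_vec y \<Longrightarrow> x \<bullet> y \<in> \<int>"
  by (simp add: integral_vec_def inner_vec_def Ints_sum)

definition shear :: "'n \<Rightarrow> 'n \<Rightarrow> real \<Rightarrow> real^'n \<Rightarrow> real^'n" where
  "shear a b t x = x + (t * x $ a) *\<^sub>R axis b 1"

lemma lattice_iso_shear:
  assumes "a \<noteq> b" "t \<in> \<int>" shows "lattice_iso (shear a b t) (shear a b (- t))"
  using assms unfolding lattice_iso_def shear_def
  by (auto simp: linear_iff algebra_simps axis_def integral_vec_def vec_eq_iff)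

lemma shear_nth: "k \<noteq> b \<Longrightarrow> shear a b t x $ k = x $ k"
  by (simp add: shear_def axis_def)

text \<open>The matrix is the identity with row \<open>k\<close> replaced by \<open>w\<close>; its
  determinant is \<open>w $ k\<close>, a unit.\<close>

lemma lattice_iso_substitute:
  fixes w :: "real^'n"
  assumes w: "integral_vec w" and e: "w $ k = 1 \<or> w $ k = -1"
  shows "\<exists>f g. lattice_iso f g \<and> (\<forall>x. f x $ k = w \<bullet> x) \<and> (\<forall>x. \<forall>j. j \<noteq> k \<longrightarrow> f x $ j = x $ j)"
proof -
  define f where "f x = x + (w \<bullet> x - x $ k) *\<^sub>R axis k 1" for x :: "real^'n"
  \<comment> \<open>Solves \<open>w \<bullet> x = y $ k\<close> for the coordinate
    \<open>x $ k\<close>, using that \<open>w $ k\<close> is its own inverse.\<close>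
  define g where "g y = y + (w $ k * (y $ k - w \<bullet> y + w $ k * y $ k) - y $ k) *\<^sub>R axis k 1" for y :: "real^'n"
  have ee: "w $ k * w $ k = 1" using e by auto
  have ax: "w \<bullet> axis k 1 = w $ k" by (simp add: inner_axis)
  have fk: "f x $ k = w \<bullet> x" and fj: "j \<noteq> k \<Longrightarrow> f x $ j = x $ j" for x j
    by (simp_all add: f_def axis_def)
  have gk: "g y $ k = w $ k * (y $ k - w \<bullet> y + w $ k * y $ k)" and gj: "j \<noteq> k \<Longrightarrow> g y $ j = y $ j" for y j
    by (simp_all add: g_def axis_def)
  have wf: "w \<bullet> f x = w \<bullet> x + (w \<bullet> x - x $ k) * w $ k" for x
    by (simp add: f_def inner_add_right ax)
  have wg: "w \<bullet> g y = y $ k" for y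
  proof -
    have "w \<bullet> g y = w \<bullet> y + (w $ k * (y $ k - w \<bullet> y + w $ k * y $ k) - y $ k) * w $ k"
      by (simp add: g_def inner_add_right ax)
    also have "\<dots> = w \<bullet> y + (w $ k * w $ k) * (y $ k - w \<bullet> y + w $ k * y $ k) - y $ k * w $ k"
      by (simp add: algebra_simps)
    finally show ?thesis by (simp add: ee)
  qed
  have "g (f x) $ k = x $ k" for x
  proof -
    have "g (f x) $ k = (w $ k * w $ k) * x $ k" unfolding gk fk wf by (simp add: algebra_simps)
    then show ?thesis by (simp add: ee)
  qed
  then have gf: "g (f x) = x" for x unfolding vec_eq_iff by (metis fj gj)
  have fg: "f (g y) = y" for y unfolding vec_eq_iff by (metis fj gj fk wg)
  have "linear f" "linear g"
    unfolding f_def g_def linear_iff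
    by (auto simp: vec_eq_iff inner_add_right algebra_simps)
  moreover have "integral_vec (f x)" "integral_vec (g x)" if "integral_vec x" for x
  proof -
    have "w $ k \<in> \<int>" "x $ k \<in> \<int>" using w that by (auto simp: integral_vec_def)
    then show "integral_vec (f x)" "integral_vec (g x)"
      using integral_vec_inner[OF w that] unfolding f_def g_def
      by (auto intro!: integral_vec_add[OF that] integral_vec_scale integral_vec_axis)
  qed
  ultimately have "lattice_iso f g" unfolding lattice_iso_def using fg gf by blast
  then show ?thesis using fk fj by blast
qed

text \<open>The subtractive Euclidean algorithm on the entries of \<open>w\<close> outside \<open>K\<close>.\<close>
lemma unimodular_row_completion:
  fixes w d :: "real^'n"
  assumes "integral_vec w" "integral_vec d" "w \<bullet> d = 1" "\<forall>k\<in>K. d $ k = 0"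
  shows "\<exists>f g k0. lattice_iso f g \<and> k0 \<notin> K \<and> (\<forall>x. f x $ k0 = w \<bullet> x) \<and> (\<forall>x. \<forall>k\<in>K. f x $ k = x $ k)"
proof -
  obtain n where "(\<Sum>j\<in>- K. \<bar>w $ j\<bar>) \<le> real n" using real_arch_simple by blast
  then show ?thesis using assms
  proof (induction n arbitrary: w d rule: less_induct)
    case (less n)
    have abs_ge_1: "1 \<le> \<bar>w $ j\<bar>" if "w $ j \<noteq> 0" for j
      using that less.prems(2) Ints_nonzero_abs_ge1 unfolding integral_vec_def by blast
    show ?case
    proof (cases "\<exists>a b. a \<notin> K \<and> b \<notin> K \<and> a \<noteq> b \<and> w $ a \<noteq> 0 \<and> w $ b \<noteq> 0")
      case True
      then obtain a b where ab: "a \<notin> K" "b \<notin> K" "a \<noteq> b" "w $ a \<noteq> 0" "w $ b \<noteq> 0" "\<bar>w $ b\<bar> \<le> \<bar>w $ a\<bar>"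
        by (metis linear)
      \<comment> \<open>With this sign the larger entry loses the absolute value of the smaller one,
        so the sum of absolute values outside \<open>K\<close> drops by at least 1.\<close>
      define c where "c = - sgn (w $ a) * sgn (w $ b)"
      have cZ: "c \<in> \<int>" by (auto simp: c_def sgn_if)
      define w' where "w' = w + (c * w $ b) *\<^sub>R axis a 1"
      \<comment> \<open>The contragredient operation: it keeps the pairing with \<open>w\<close>, so
        a completion of \<open>w'\<close> composed with \<open>s\<close> completes \<open>w\<close>.
        Only coordinate \<open>b\<close>, outside \<open>K\<close>, changes.\<close>
      define s where "s = shear a b (- c)"
      have iso: "lattice_iso s (shear a b c)"
        using lattice_iso_shear[of a b "- c"] ab(3) cZ by (simp add: s_def)
      have w's: "w' \<bullet> s x = w \<bullet> x" for x
      proof -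
        have "axis a (1::real) $ b = 0" using ab(3) by (simp add: axis_def)
        then show ?thesis
          by (simp add: w'_def s_def shear_def inner_add_left inner_add_right inner_axis inner_axis' algebra_simps)
      qed
      have w'Z: "integral_vec w'"
        using less.prems(2) cZ unfolding w'_def
        by (intro integral_vec_add integral_vec_scale integral_vec_axis) (auto simp: integral_vec_def)
      have "\<bar>w' $ a\<bar> = \<bar>w $ a\<bar> - \<bar>w $ b\<bar>"
        using ab by (auto simp: w'_def c_def axis_def sgn_if abs_if)
      moreover have "w' $ j = w $ j" if "j \<noteq> a" for j using that by (simp add: w'_def axis_def)
      ultimately have "(\<Sum>j\<in>- K. \<bar>w' $ j\<bar>) = (\<Sum>j\<in>- K. \<bar>w $ j\<bar>) - \<bar>w $ b\<bar>"
        using ab(1) by (simp add: sum.remove[of "- K" a])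
      then have w'_le: "(\<Sum>j\<in>- K. \<bar>w' $ j\<bar>) \<le> real n - 1"
        using less.prems(1) abs_ge_1[OF ab(5)] by linarith
      have "0 \<le> (\<Sum>j\<in>- K. \<bar>w' $ j\<bar>)" by (simp add: sum_nonneg)
      then have "real n \<ge> 1" using w'_le by linarith
      then have n: "n > 0" "real (n - 1) = real n - 1" by auto
      have "\<exists>f g k0. lattice_iso f g \<and> k0 \<notin> K \<and> (\<forall>x. f x $ k0 = w' \<bullet> x) \<and> (\<forall>x. \<forall>k\<in>K. f x $ k = x $ k)"
      proof (rule less.IH[of "n - 1" w' "s d"])
        show "integral_vec (s d)" using iso less.prems(3) unfolding lattice_iso_def by blast
        show "\<forall>k\<in>K. s d $ k = 0" using less.prems(5) ab(2) unfolding s_def by (metis shear_nth)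
      qed (use n w'_le w'Z w's less.prems(4) in auto)
      then obtain f g k0 where f: "lattice_iso f g" "k0 \<notin> K" "\<forall>x. f x $ k0 = w' \<bullet> x" "\<forall>x. \<forall>k\<in>K. f x $ k = x $ k"
        by blast
      have "\<forall>x. \<forall>k\<in>K. s x $ k = x $ k" using ab(2) unfolding s_def by (metis shear_nth)
      then have "\<forall>x. (f \<circ> s) x $ k0 = w \<bullet> x" "\<forall>x. \<forall>k\<in>K. (f \<circ> s) x $ k = x $ k"
        using f(3,4) w's by auto
      then show ?thesis using lattice_iso_compose[OF iso f(1)] f(2) by blast
    next
      case False
      \<comment> \<open>The vector \<open>d\<close> certifies that the entries of \<open>w\<close>
        outside \<open>K\<close> are coprime. When only one nonzero entry is left there, it must be
        a unit.\<close>
      have split: "(\<Sum>j\<in>- K. w $ j * d $ j) = 1"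
      proof -
        have "w \<bullet> d = (\<Sum>j\<in>UNIV. w $ j * d $ j)" by (simp add: inner_vec_def)
        also have "\<dots> = (\<Sum>j\<in>- K. w $ j * d $ j)"
          using less.prems(5) by (intro sum.mono_neutral_right) auto
        finally show ?thesis using less.prems(4) by simp
      qed
      have "\<exists>k0\<in>- K. w $ k0 * d $ k0 \<noteq> 0"
      proof (rule ccontr)
        assume "\<not> ?thesis"
        then have "(\<Sum>j\<in>- K. w $ j * d $ j) = 0" by (intro sum.neutral) blast
        then show False using split by simp
      qed
      then obtain k0 where k0: "k0 \<notin> K" "w $ k0 \<noteq> 0" by auto
      then have "w $ j = 0" if "j \<notin> K" "j \<noteq> k0" for j using False that by blast
      then have "(\<Sum>j\<in>- K. w $ j * d $ j) = w $ k0 * d $ k0"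
        using k0(1) by (simp add: sum.remove[of "- K" k0])
      then have prod: "w $ k0 * d $ k0 = 1" using split by simp
      obtain p q :: int where pq: "w $ k0 = of_int p" "d $ k0 = of_int q"
        using less.prems(2,3) unfolding integral_vec_def by (metis Ints_cases)
      then have "p * q = 1" using prod by (metis of_int_eq_1_iff of_int_mult)
      then have "p = 1 \<or> p = -1" using zmult_eq_1_iff by blast
      then have "w $ k0 = 1 \<or> w $ k0 = -1" using pq by auto
      then obtain f g where "lattice_iso f g" "\<forall>x. f x $ k0 = w \<bullet> x" "\<forall>x. \<forall>j. j \<noteq> k0 \<longrightarrow> f x $ j = x $ j"
        using lattice_iso_substitute[OF less.prems(2)] by blast
      then show ?thesis using k0(1) by (intro exI[of _ f] exI[of _ g] exI[of _ k0]) auto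
    qed
  qed
qed

text \<open>The dual system \<open>d\<close> guarantees that the \<open>w i\<close> extend to a
  lattice basis. In the coordinates found so far, \<open>f (d s)\<close> vanishes on the used
  positions, so the next row can be completed without disturbing them.\<close>

lemma unimodular_completion:
  fixes w d :: "nat \<Rightarrow> real^'n"
  assumes "\<And>i. i < s \<Longrightarrow> integral_vec (w i)" "\<And>i. i < s \<Longrightarrow> integral_vec (d i)"
    and "\<And>i j. i < s \<Longrightarrow> j < s \<Longrightarrow> w i \<bullet> d j = (if i = j then 1 else 0)"
  shows "\<exists>f g k. lattice_iso f g \<and> inj_on k {..<s} \<and> (\<forall>i<s. \<forall>x. f x $ k i = w i \<bullet> x)"
  using assms
proof (induction s)
  case 0
  then show ?case using lattice_iso_id by (intro exI) auto
next
  case (Suc s)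
  have "\<exists>f g k. lattice_iso f g \<and> inj_on k {..<s} \<and> (\<forall>i<s. \<forall>x. f x $ k i = w i \<bullet> x)"
    by (rule Suc.IH) (auto simp: Suc.prems)
  then obtain f g k where f: "lattice_iso f g" "inj_on k {..<s}" "\<forall>i<s. \<forall>x. f x $ k i = w i \<bullet> x"
    by blast
  have lin: "linear f" "linear g" and gf: "\<And>x. g (f x) = x"
    and fZ: "\<And>x. integral_vec x \<Longrightarrow> integral_vec (f x)" and gZ: "\<And>x. integral_vec x \<Longrightarrow> integral_vec (g x)"
    using f(1) unfolding lattice_iso_def by auto
  \<comment> \<open>The functional \<open>w s\<close> expressed in the coordinates given by
    \<open>f\<close>.\<close>
  define w' where "w' = adjoint g (w s)"
  have w': "w' \<bullet> y = w s \<bullet> g y" for y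
    unfolding w'_def using adjoint_works[OF lin(2)] by (metis inner_commute)
  have w's: "integral_vec (w s)" using Suc.prems(1) by simp
  have "w' $ j \<in> \<int>" for j
  proof -
    have "w' $ j = w s \<bullet> g (axis j 1)" using w'[of "axis j 1"] by (simp add: inner_axis)
    also have "\<dots> \<in> \<int>" using w's by (intro integral_vec_inner gZ integral_vec_axis) auto
    finally show ?thesis .
  qed
  then have "integral_vec w'" by (simp add: integral_vec_def)
  moreover have "integral_vec (f (d s))" using Suc.prems(2) fZ by simp
  moreover have "w' \<bullet> f (d s) = 1" using w' gf Suc.prems(3)[of s s] by simp
  moreover have "\<forall>l\<in>k ` {..<s}. f (d s) $ l = 0" using f(3) Suc.prems(3)[of _ s] by auto
  ultimately obtain f2 g2 k0 where f2: "lattice_iso f2 g2" "k0 \<notin> k ` {..<s}" "\<forall>x. f2 x $ k0 = w' \<bullet> x"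
    "\<forall>x. \<forall>l\<in>k ` {..<s}. f2 x $ l = x $ l"
    using unimodular_row_completion[of w' "f (d s)" "k ` {..<s}"] by blast
  show ?case
  proof (intro exI conjI)
    show "lattice_iso (f2 \<circ> f) (g \<circ> g2)" by (rule lattice_iso_compose[OF f(1) f2(1)])
    show "inj_on (k(s := k0)) {..<Suc s}"
      using f(2) f2(2) by (auto simp: inj_on_def less_Suc_eq)
    show "\<forall>i<Suc s. \<forall>x. (f2 \<circ> f) x $ (k(s := k0)) i = w i \<bullet> x"
      using f(3) f2(3,4) w' gf by (auto simp: less_Suc_eq)
  qed
qed

text \<open>The matrices of \<open>f\<close> and \<open>g\<close> are integral and inverse to each
  other, so their determinants are integers with product 1.\<close>

lemma lattice_affine_isoI:
  assumes fg: "lattice_iso f g" and b: "integral_vec b"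
  shows "lattice_affine_iso (\<lambda>x. f x + b)"
  unfolding lattice_affine_iso_def
proof (intro exI conjI allI)
  have lin: "linear f" "linear g" using fg unfolding lattice_iso_def by auto
  have Z: "matrix h $ i $ j \<in> \<int>" if "h = f \<or> h = g" for h i j
  proof -
    have "integral_vec (h (axis j 1))"
      using that fg integral_vec_axis[OF Ints_1] unfolding lattice_iso_def by blast
    then show ?thesis by (simp add: matrix_def integral_vec_def)
  qed
  show "matrix f $ i $ j \<in> \<int>" for i j using Z by blast
  have detZ: "det (matrix h) \<in> \<int>" if "h = f \<or> h = g" for h
    unfolding det_def using Z[OF that] by (intro Ints_sum Ints_mult Ints_prod) (auto simp: sign_def)
  have "matrix f ** matrix g = mat 1"
  proof -
    have "f \<circ> g = id" using fg unfolding lattice_iso_def by auto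
    then show ?thesis using matrix_compose[OF lin(2,1)] by (simp add: matrix_id_mat_1)
  qed
  then have "det (matrix f) * det (matrix g) = 1" by (metis det_I det_mul)
  moreover obtain p q :: int where pq: "det (matrix f) = of_int p" "det (matrix g) = of_int q"
    using detZ by (metis Ints_cases)
  ultimately have "p * q = 1" by (metis of_int_eq_1_iff of_int_mult)
  then have "p = 1 \<or> p = -1" using zmult_eq_1_iff by blast
  then show "det (matrix f) = 1 \<or> det (matrix f) = -1" using pq by auto
  show "f x + b = matrix f *v x + b" for x using fun_cong[OF matrix_vector_mul(2)[OF lin(1)], of x] by simp
qed (rule b)

section \<open>From integral functionals to a Cayley sum\<close>

lemma convex_hull_Un_hulls:
  "convex hull (convex hull A \<union> (\<Union>i\<in>I. convex hull (F i))) = convex hull (A \<union> (\<Union>i\<in>I. F i))"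
proof (rule subset_antisym)
  show "convex hull (convex hull A \<union> (\<Union>i\<in>I. convex hull (F i))) \<subseteq> convex hull (A \<union> (\<Union>i\<in>I. F i))"
    by (intro hull_minimal Un_least UN_least hull_mono) auto
  show "convex hull (A \<union> (\<Union>i\<in>I. F i)) \<subseteq> convex hull (convex hull A \<union> (\<Union>i\<in>I. convex hull (F i)))"
    by (intro hull_mono Un_mono UN_mono hull_subset subset_refl)
qed

text \<open>Exactly one of the \<open>s + 1\<close> functionals is 1 on each point, so the first
  \<open>s\<close> suffice as coordinates, and the points with last functional 1 form the summand
  \<open>None\<close>. If \<open>p i\<close> has value 1 under functional \<open>i\<close>, the
  differences \<open>p i - p s\<close> are a dual system for the first \<open>s\<close> linear
  parts.\<close>

lemma cayley_decomp_of_functionals: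
  fixes V :: "(real^'n) set" and w :: "nat \<Rightarrow> real^'n" and b :: "nat \<Rightarrow> real"
  assumes V: "finite V" "\<forall>v\<in>V. integral_vec v"
    and w: "\<And>i. i \<le> s \<Longrightarrow> integral_vec (w i)" and b: "\<And>i. i \<le> s \<Longrightarrow> b i \<in> \<int>"
    and one: "\<And>v. v \<in> V \<Longrightarrow> \<exists>i\<le>s. \<forall>j\<le>s. w j \<bullet> v + b j = (if j = i then 1 else 0)"
    and onto: "\<And>i. i \<le> s \<Longrightarrow> \<exists>v\<in>V. w i \<bullet> v + b i = 1"
  shows "\<exists>T S. lattice_affine_iso T \<and> card S = s \<and> cayley_decomp_coords (T ` (convex hull V)) S"
proof -
  obtain p where p: "\<And>i. i \<le> s \<Longrightarrow> p i \<in> V \<and> w i \<bullet> p i + b i = 1" using onto by metis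
  have wp: "w i \<bullet> p j + b i = (if i = j then 1 else 0)" if "i \<le> s" "j \<le> s" for i j
    using p[OF that(2)] one[of "p j"] that by (metis zero_neq_one)
  have "w i \<bullet> (p j - p s) = (if i = j then 1 else 0)" if "i < s" "j < s" for i j
    using wp[of i j] wp[of i s] that by (simp add: inner_diff_right split: if_splits)
  moreover have "integral_vec (p i - p s)" if "i < s" for i
    using that p[of i] p[of s] V(2) by (intro integral_vec_diff) auto
  ultimately obtain f g k where f: "lattice_iso f g" "inj_on k {..<s}" "\<forall>i<s. \<forall>x. f x $ k i = w i \<bullet> x"
    using unimodular_completion[of s w "\<lambda>i. p i - p s"] w by auto
  define c where "c = (\<Sum>i<s. b i *\<^sub>R axis (k i) (1::real))"
  define T where "T x = f x + c" for x
  define S where "S = k ` {..<s}"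
  have c: "c $ k i = b i" if "i < s" for i
  proof -
    have "c $ k i = (\<Sum>j<s. if j = i then b j else 0)"
      unfolding c_def sum_component using f(2) that
      by (intro sum.cong) (auto simp: axis_def dest: inj_onD)
    then show ?thesis using that by simp
  qed
  have cZ: "integral_vec c"
    unfolding integral_vec_def c_def sum_component using b by (auto intro!: Ints_sum simp: axis_def)
  have T: "T x $ k i = w i \<bullet> x + b i" if "i < s" for x i
    using f(3) c that by (simp add: T_def)
  have iso: "lattice_affine_iso T" using lattice_affine_isoI[OF f(1) cZ] by (simp add: T_def[abs_def])
  have TZ: "integral_vec (T v)" if "v \<in> V" for v
    using that V(2) f(1) cZ unfolding T_def lattice_iso_def by (auto intro: integral_vec_add)
  have cases: "(\<forall>l\<in>S. T v $ l = 0) \<or> (\<exists>l\<in>S. T v $ l = 1)" if "v \<in> V" for v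
    using one[OF that] T unfolding S_def by (metis (no_types, lifting) image_iff lessThan_iff nat_less_le)
  have others: "T v $ l' = 0" if vl: "v \<in> V" "l \<in> S" "l' \<in> S" "T v $ l = 1" "l' \<noteq> l" for v l l'
  proof -
    obtain i where i: "\<And>j. j \<le> s \<Longrightarrow> w j \<bullet> v + b j = (if j = i then 1 else 0)" using one[OF vl(1)] by blast
    obtain x x' where x: "x < s" "l = k x" "x' < s" "l' = k x'" using vl(2,3) unfolding S_def by auto
    have "x = i" using i[of x] T[of x v] x vl(4) by (simp split: if_splits)
    then show ?thesis using i[of x'] T[of x' v] x vl(5) by (auto split: if_splits)
  qed
  define A where "A j = (case j of None \<Rightarrow> T ` {v\<in>V. \<forall>l\<in>S. T v $ l = 0}
      | Some l \<Rightarrow> (\<lambda>v. T v - axis l 1) ` {v\<in>V. T v $ l = 1})" for j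
  have A_fin: "finite (A j)" for j using V(1) by (auto simp: A_def split: option.splits)
  have A_Z: "integral_vec x" if "x \<in> A j" for x j
    using that TZ by (auto simp: A_def split: option.splits intro!: integral_vec_diff integral_vec_axis)
  have A_ne: "A j \<noteq> {}" if "j \<in> insert None (Some ` S)" for j
  proof -
    have "\<forall>l\<in>S. T (p s) $ l = 0" unfolding S_def using T wp by auto
    moreover have "T (p i) $ k i = 1" if "i < s" for i using T wp that by auto
    ultimately show ?thesis using that p unfolding A_def S_def by fastforce
  qed
  have A_0: "x $ l = 0" if jxl: "j \<in> insert None (Some ` S)" "x \<in> A j" "l \<in> S" for j x l
  proof (cases j)
    case None
    then show ?thesis using that by (auto simp: A_def)
  next
    case (Some l0)
    then obtain v where "v \<in> V" "T v $ l0 = 1" "x = T v - axis l0 1" "l0 \<in> S"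
      using jxl(1,2) by (auto simp: A_def)
    then show ?thesis using others[of v l0 l] jxl(3) by (cases "l = l0") (auto simp: axis_def)
  qed
  have hull_0: "x $ l = 0" if "j \<in> insert None (Some ` S)" "x \<in> convex hull (A j)" "l \<in> S" for j x l
  proof -
    have "convex {x::real^'n. x $ l = 0}" by (auto simp: convex_def)
    then have "convex hull (A j) \<subseteq> {x. x $ l = 0}" using A_0[OF that(1) _ that(3)] by (intro hull_minimal) auto
    then show ?thesis using that(2) by blast
  qed
  have "cayley_decomp_coords (T ` (convex hull V)) S"
    unfolding cayley_decomp_coords_def
  proof (intro exI[of _ "\<lambda>j. convex hull (A j)"] conjI ballI)
    fix j assume j: "j \<in> insert None (Some ` S)"
    show "lattice_polytope (convex hull (A j))"
      unfolding lattice_polytope_def using A_fin A_Z A_ne[OF j] by blast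
    show "x $ l = 0" if "x \<in> convex hull (A j)" "l \<in> S" for x l using hull_0 j that by blast
  next
    have tr: "(\<lambda>x. x + axis l 1) ` (convex hull (A (Some l))) = convex hull (T ` {v\<in>V. T v $ l = 1})" for l
    proof -
      have "(\<lambda>x. x + axis l 1) ` (convex hull (A (Some l))) = convex hull ((+) (axis l 1) ` A (Some l))"
        using convex_hull_translation[of "axis l 1" "A (Some l)"] by (simp add: add.commute[of _ "axis l 1"])
      also have "(+) (axis l 1) ` A (Some l) = T ` {v\<in>V. T v $ l = 1}"
        by (simp add: A_def image_image)
      finally show ?thesis .
    qed
    have "T ` (convex hull V) = (+) c ` (f ` (convex hull V))"
      by (simp add: T_def[abs_def] image_image add.commute)
    also have "\<dots> = (+) c ` (convex hull (f ` V))"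
      using f(1) convex_hull_linear_image unfolding lattice_iso_def by metis
    also have "\<dots> = convex hull ((+) c ` (f ` V))" by (rule convex_hull_translation[symmetric])
    also have "(+) c ` (f ` V) = T ` V" by (simp add: T_def[abs_def] image_image add.commute)
    also have "T ` V = A None \<union> (\<Union>l\<in>S. T ` {v\<in>V. T v $ l = 1})"
      using cases by (auto simp: A_def)
    finally show "T ` (convex hull V) =
        convex hull (convex hull (A None) \<union> (\<Union>l\<in>S. (\<lambda>x. x + axis l 1) ` (convex hull (A (Some l)))))"
      unfolding tr convex_hull_Un_hulls .
  qed
  moreover have "card S = s" unfolding S_def using f(2) by (simp add: card_image)
  ultimately show ?thesis using iso by blast
qed


section \<open>The cone over a lattice polytope\<close>

lemma mem_int_points_prod: "((x :: real^'n, t :: real) \<in> int_points) \<longleftrightarrow> integral_vec x \<and> t \<in> \<int>"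
  by (auto simp: int_points_def integral_vec_def Basis_prod_def Basis_vec_def inner_axis ball_Un)

text \<open>A nonzero vector orthogonal to the lifted points would be a nontrivial affine equation
  satisfied by \<open>V\<close>.\<close>

lemma span_lift_UNIV:
  fixes V :: "(real^'n) set"
  assumes "aff_dim V = int CARD('n)"
  shows "span ((\<lambda>v. (v, 1::real)) ` V) = UNIV"
proof (rule ccontr)
  assume "span ((\<lambda>v. (v, 1::real)) ` V) \<noteq> UNIV"
  then obtain a where a: "a \<noteq> 0" "\<forall>x\<in>span ((\<lambda>v. (v, 1::real)) ` V). a \<bullet> x = 0"
    using span_not_UNIV_orthogonal by blast
  obtain w t where wt: "a = (w, t)" by (cases a)
  have eq: "w \<bullet> v + t = 0" if "v \<in> V" for v
    using a(2) real_vector.span_base[of "(v, 1)" "(\<lambda>v. (v, 1::real)) ` V"] that wt by auto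
  have "V \<noteq> {}" using assms by auto
  show False
  proof (cases "w = 0")
    case True
    then show False using eq \<open>V \<noteq> {}\<close> a(1) wt by (auto simp: zero_prod_def)
  next
    case False
    have "V \<subseteq> {x. w \<bullet> x = - t}" using eq by (auto simp: eq_neg_iff_add_eq_0)
    then have "aff_dim V \<le> int CARD('n) - 1"
      using aff_dim_subset[of V "{x. w \<bullet> x = - t}"] False by simp
    then show False using assms by simp
  qed
qed

lemma lift_mem_nonneg_comb:
  fixes V :: "'a::real_vector set"
  assumes "finite V" "V \<noteq> {}" "0 \<le> t"
  shows "(x, t) \<in> nonneg_comb ((\<lambda>v. (v, 1::real)) ` V) \<longleftrightarrow> x \<in> (\<lambda>y. t *\<^sub>R y) ` (convex hull V)"
proof
  have inj: "inj_on (\<lambda>v. (v, 1::real)) V" by (simp add: inj_on_def)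
  have sum: "(\<Sum>z\<in>(\<lambda>v. (v, 1::real)) ` V. c z *\<^sub>R z) = (\<Sum>v\<in>V. c (v, 1) *\<^sub>R v, \<Sum>v\<in>V. c (v, 1))" for c :: "'a \<times> real \<Rightarrow> real"
    using inj assms(1) by (simp add: sum.reindex sum_prod)
  {
    assume "(x, t) \<in> nonneg_comb ((\<lambda>v. (v, 1::real)) ` V)"
    then obtain c :: "'a \<times> real \<Rightarrow> real" where c: "\<forall>v\<in>V. c (v, 1) \<ge> 0" "x = (\<Sum>v\<in>V. c (v, 1) *\<^sub>R v)" "t = (\<Sum>v\<in>V. c (v, 1))"
    proof -
      obtain c where c: "\<forall>z\<in>(\<lambda>v. (v, 1::real)) ` V. c z \<ge> 0" "(x, t) = (\<Sum>z\<in>(\<lambda>v. (v, 1::real)) ` V. c z *\<^sub>R z)"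
        using \<open>(x, t) \<in> _\<close> unfolding nonneg_comb_def by blast
      then show ?thesis using c(1) by (intro that[of c]) (auto simp: sum)
    qed
    show "x \<in> (\<lambda>y. t *\<^sub>R y) ` (convex hull V)"
    proof (cases "t = 0")
      \<comment> \<open>At height 0 the cone contains only the origin, which equals
        \<open>0 *\<^sub>R y\<close> for any \<open>y\<close> in the nonempty hull.\<close>
      case True
      then have "\<forall>v\<in>V. c (v, 1) = 0" using c(1,3) assms(1) by (simp add: sum_nonneg_eq_0_iff)
      then have "x = 0" using c(2) by simp
      then show ?thesis using True assms(2) by (auto simp: image_constant_conv)
    next
      case False
      have "(\<Sum>v\<in>V. (c (v, 1) / t) *\<^sub>R v) \<in> convex hull V"
        unfolding convex_hull_finite[OF assms(1)] using c assms(3) False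
        by (auto intro!: exI[of _ "\<lambda>v. c (v, 1) / t"] simp: sum_divide_distrib[symmetric])
      moreover have "x = t *\<^sub>R (\<Sum>v\<in>V. (c (v, 1) / t) *\<^sub>R v)"
        using False by (simp add: c(2) scaleR_sum_right)
      ultimately show ?thesis by blast
    qed
  }
  {
    assume "x \<in> (\<lambda>y. t *\<^sub>R y) ` (convex hull V)"
    then obtain a where a: "\<forall>v\<in>V. 0 \<le> a v" "(\<Sum>v\<in>V. a v) = 1" "x = t *\<^sub>R (\<Sum>v\<in>V. a v *\<^sub>R v)"
      unfolding convex_hull_finite[OF assms(1)] by auto
    have "(x, t) = (\<Sum>z\<in>(\<lambda>v. (v, 1::real)) ` V. (t * a (fst z)) *\<^sub>R z)"
      using sum[of "\<lambda>z. t * a (fst z)"] a by (simp add: scaleR_sum_right sum_distrib_left[symmetric])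
    moreover have "(\<Sum>z\<in>(\<lambda>v. (v, 1::real)) ` V. (t * a (fst z)) *\<^sub>R z) \<in> nonneg_comb ((\<lambda>v. (v, 1::real)) ` V)"
      using a(1) assms(3) by (intro nonneg_combI) auto
    ultimately show "(x, t) \<in> nonneg_comb ((\<lambda>v. (v, 1::real)) ` V)" by simp
  }
qed

lemma integral_partition_of_one:
  fixes f :: "nat \<Rightarrow> real"
  assumes "\<And>i. i \<le> s \<Longrightarrow> f i \<in> \<int>" "\<And>i. i \<le> s \<Longrightarrow> 0 \<le> f i" "(\<Sum>i\<le>s. f i) = 1"
  shows "\<exists>i\<le>s. \<forall>j\<le>s. f j = (if j = i then 1 else 0)"
proof -
  have ge: "1 \<le> f i" if "i \<le> s" "f i \<noteq> 0" for i
    using assms(1,2)[OF that(1)] that(2) Ints_nonzero_abs_ge1[of "f i"] by simp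
  obtain i where i: "i \<le> s" "f i \<noteq> 0"
    using assms(3) by (metis atMost_iff sum.neutral zero_neq_one)
  have split: "f i + (\<Sum>j\<in>{..s} - {i}. f j) = 1"
    using assms(3) i(1) by (simp add: sum.remove[of "{..s}" i])
  have nn: "0 \<le> (\<Sum>j\<in>{..s} - {i}. f j)" using assms(2) by (intro sum_nonneg) auto
  then have "(\<Sum>j\<in>{..s} - {i}. f j) = 0" "f i = 1" using split ge[OF i] by linarith+
  then have "f j = 0" if "j \<le> s" "j \<noteq> i" for j
    using assms(2) that sum_nonneg_eq_0_iff[of "{..s} - {i}" f] by simp
  then show ?thesis using i(1) \<open>f i = 1\<close> by auto
qed

theorem theorem3p1:
  fixes P :: "(real^'n) set" and d :: nat
  assumes "lattice_polytope P"
    and "aff_dim P = int CARD('n)"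
    and "gorenstein P"
    and "has_degree P d"
  shows "\<exists>q. q \<le> 2 * d - 1 \<and> cayley_decomposes_in_dim P q"
proof -
  obtain V where V: "finite V" "V \<noteq> {}" "\<forall>v\<in>V. integral_vec v" "P = convex hull V"
    using assms(1) unfolding lattice_polytope_def by blast
  define W where "W = (\<lambda>v. (v, 1::real)) ` V"
  define u where "u = (0 :: real^'n, 1 :: real)"
  have spanW: "span W = UNIV"
    unfolding W_def using assms(2) V(4) by (intro span_lift_UNIV) (simp add: aff_dim_convex_hull)
  interpret cone: height_one_cone W u
  proof
    show "finite W" "span W = UNIV" using V(1) spanW by (auto simp: W_def)
    show "W \<subseteq> int_points" "u \<in> int_points"
      using V(3) by (auto simp: W_def u_def mem_int_points_prod integral_vec_def)
    show "v \<bullet> u = 1" if "v \<in> W" for v using that by (auto simp: W_def u_def)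
  qed
  have slice: "cone.slice (nonneg_comb W) k = (\<lambda>x. (x, real k)) ` {x \<in> (\<lambda>y. real k *\<^sub>R y) ` P. integral_vec x}" for k
  proof -
    have "(x, t) \<in> cone.slice (nonneg_comb W) k \<longleftrightarrow>
        t = real k \<and> x \<in> (\<lambda>y. real k *\<^sub>R y) ` P \<and> integral_vec x" for x t
    proof -
      have "(x, real k) \<in> nonneg_comb W \<longleftrightarrow> x \<in> (\<lambda>y. real k *\<^sub>R y) ` P"
        unfolding W_def V(4) by (rule lift_mem_nonneg_comb[OF V(1,2)]) simp
      moreover have "(x, t) \<bullet> u = t" by (simp add: u_def)
      ultimately show ?thesis unfolding cone.slice_def by (auto simp: mem_int_points_prod)
    qed
    then show ?thesis by auto
  qed
  have "card (cone.slice (nonneg_comb W) k) = ehrhart P k" for k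
    unfolding slice ehrhart_def by (subst card_image) (auto simp: inj_on_def)
  \<comment> \<open>The exponent \<open>CARD('n) + 1\<close> in \<open>hstar\<close> is the
    dimension of the product space.\<close>
  then have H: "cone.gf (nonneg_comb W) * (1 - fps_X) ^ DIM((real^'n) \<times> real) = hstar P"
    unfolding cone.gf_def hstar_def by simp
  have deg: "fps_nth (hstar P) d \<noteq> 0" "\<And>i. i > d \<Longrightarrow> fps_nth (hstar P) i = 0"
    using assms(4) unfolding has_degree_def by auto
  have sym: "fps_nth (hstar P) i = fps_nth (hstar P) (d - i)" if "i \<le> d" for i
  proof -
    obtain d' where d': "has_degree P d'" "\<forall>i\<le>d'. fps_nth (hstar P) i = fps_nth (hstar P) (d' - i)"
      using assms(3) unfolding gorenstein_def by blast
    \<comment> \<open>The degree is unique, so the symmetry asserted for some degree holds for the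
      given \<open>d\<close>.\<close>
    then have "d' = d" using assms(4) unfolding has_degree_def by (metis linorder_neqE_nat)
    then show ?thesis using d'(2) that by blast
  qed
  note G = cone.gorenstein_point[of d, unfolded H, OF deg sym]
  obtain m where m: "m \<in> pos_comb W" "m \<in> int_points" "m \<bullet> u = real (DIM((real^'n) \<times> real) - d)"
    "\<forall>x\<in>pos_comb W \<inter> int_points. x - m \<in> nonneg_comb W"
    using G(2) by blast
  interpret cone: gorenstein_cone W u m
    by unfold_locales (use m in auto)
  obtain ys where ys: "set ys \<subseteq> cone.dual_cone \<inter> int_points - {0}" "sum_list ys = u"
    "DIM((real^'n) \<times> real) \<le> length ys + (2 * d - 1)"
    using cone.unit_decomposition[OF m(3) G(1)] by blast
  define s where "s = length ys - 1"
  have "ys \<noteq> []" using ys(2) by (auto simp: u_def zero_prod_def)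
  then have len: "length ys = Suc s" by (simp add: s_def)
  have y: "ys ! i \<in> cone.dual_cone" "ys ! i \<in> int_points" "ys ! i \<noteq> 0" if "i \<le> s" for i
  proof -
    have "ys ! i \<in> set ys" using len that by simp
    then show "ys ! i \<in> cone.dual_cone" "ys ! i \<in> int_points" "ys ! i \<noteq> 0" using ys(1) by auto
  qed
  have sum: "(\<Sum>i\<le>s. ys ! i) = u"
    using ys(2) len by (simp add: sum_list_sum_nth atLeast0LessThan lessThan_Suc_atMost)
  define w b where "w i = fst (ys ! i)" and "b i = snd (ys ! i)" for i
  have yv: "ys ! i \<bullet> (v, 1) = w i \<bullet> v + b i" for i v
    unfolding w_def b_def by (simp add: inner_prod_def)
  have part: "\<exists>i\<le>s. \<forall>j\<le>s. w j \<bullet> v + b j = (if j = i then 1 else 0)" if v: "v \<in> V" for v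
  proof (rule integral_partition_of_one)
    have vW: "(v, 1) \<in> W" using v by (simp add: W_def)
    show "w i \<bullet> v + b i \<in> \<int>" if "i \<le> s" for i
      using int_points_inner[OF y(2)[OF that], of "(v, 1)"] vW cone.V_int unfolding yv by blast
    show "0 \<le> w i \<bullet> v + b i" if "i \<le> s" for i
      using y(1)[OF that] vW unfolding cone.dual_cone_def yv[symmetric] by blast
    have "(\<Sum>i\<le>s. w i \<bullet> v + b i) = (\<Sum>i\<le>s. ys ! i) \<bullet> (v, 1)" by (simp add: inner_sum_left yv)
    then show "(\<Sum>i\<le>s. w i \<bullet> v + b i) = 1" by (simp add: sum u_def)
  qed
  have "\<exists>T S. lattice_affine_iso T \<and> card S = s \<and> cayley_decomp_coords (T ` (convex hull V)) S"
  proof (rule cayley_decomp_of_functionals[OF V(1,3) _ _ part])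
    show "integral_vec (w i)" "b i \<in> \<int>" if "i \<le> s" for i
      using y(2)[OF that] mem_int_points_prod[of "w i" "b i"] by (auto simp: w_def b_def)
    \<comment> \<open>A summand that is 1 nowhere on \<open>V\<close> would vanish on the spanning
      set \<open>W\<close>, contradicting that it is nonzero.\<close>
    show "\<exists>v\<in>V. w i \<bullet> v + b i = 1" if i: "i \<le> s" for i
    proof (rule ccontr)
      assume no: "\<not> ?thesis"
      have "ys ! i \<bullet> x = 0" if "x \<in> W" for x
      proof -
        obtain v where v: "v \<in> V" "x = (v, 1)" using \<open>x \<in> W\<close> by (auto simp: W_def)
        then have "w i \<bullet> v + b i = 0" using part[OF v(1)] no i by (metis (full_types))
        then show ?thesis using v(2) yv by simp
      qed
      then have "orthogonal (ys ! i) x" if "x \<in> span W" for x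
        using that by (intro orthogonal_to_span[of x W]) (auto simp: orthogonal_def)
      then have "ys ! i \<bullet> ys ! i = 0" using spanW by (simp add: orthogonal_def)
      then show False using y(3)[OF i] by simp
    qed
  qed
  then obtain T S where TS: "lattice_affine_iso T" "card S = s" "cayley_decomp_coords (T ` P) S"
    using V(4) by blast
  have "s \<le> CARD('n)" using TS(2) card_mono[of UNIV S] by simp
  then have "cayley_decomposes_in_dim P (CARD('n) - s)"
    unfolding cayley_decomposes_in_dim_def using TS by (intro exI[of _ T] exI[of _ S]) auto
  \<comment> \<open>Both off-by-ones cancel: the space has dimension \<open>CARD('n) + 1\<close> and
    there are \<open>s + 1\<close> summands.\<close>
  moreover have "CARD('n) - s \<le> 2 * d - 1" using ys(3) len by simp
  ultimately show ?thesis by blast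
qed

end
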